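(* Let $A$ be a Marot ring. The following assertions are equivalent: (1) $A$ is a Dedekind ring. (2) $A$ is a regular-Noetherian SP-ring. (3) $A$ is a regular-Noetherian ISP-ring.
   Context: All rings are commutative with a nonzero unit. An element of a ring is regular if it is not a zero-divisor; an ideal is regular if it contains at least one regular element. A ring is Marot if each of its regular ideals is generated by regular elements. A ring is regular-Noetherian if each of its regular ideals is finitely generated. A ring is Dedekind if each of its proper regular ideals is a product of prime ideals. A proper ideal $H$ is a radical ideal if $\sqrt H=H$. A ring is an SP-ring if each of its proper regular ideals is a product of radical ideals. An ideal $J$ of $A$ is invertible if $JJ'=A$ for some $A$-submodule $J'$ of the total quotient ring $T(A)$; equivalently, $J$ is finitely generated, regular, and $J_M$ is a principal ideal of $A_M$ for each maximal ideal $M$ of $A$ (the ideal $A$ itself is allowed). A ring is an ISP-ring if every proper regular ideal of it can be written as $JH_1\cdots H_n$ with $J$ an invertible ideal, $n\ge 1$, and all $H_i$ proper radical ideals. *)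

theory Defs
  imports "HOL-Algebra.Ideal_Product" "HOL-Algebra.QuotRing" "HOL-Algebra.Module"
begin

section \<open>Regular elements and regular ideals\<close>

definition regular_elems :: "('a, 'b) ring_scheme \<Rightarrow> 'a set"
  where "regular_elems R =
    {r \<in> carrier R. \<forall>x \<in> carrier R. r \<otimes>\<^bsub>R\<^esub> x = \<zero>\<^bsub>R\<^esub> \<longrightarrow> x = \<zero>\<^bsub>R\<^esub>}"

definition regular_ideal :: "('a, 'b) ring_scheme \<Rightarrow> 'a set \<Rightarrow> bool"
  where "regular_ideal R I \<longleftrightarrow> ideal I R \<and> I \<inter> regular_elems R \<noteq> {}"

definition proper_regular_ideal :: "('a, 'b) ring_scheme \<Rightarrow> 'a set \<Rightarrow> bool"
  where "proper_regular_ideal R I \<longleftrightarrow> regular_ideal R I \<and> I \<noteq> carrier R"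

definition marot_ring :: "('a, 'b) ring_scheme \<Rightarrow> bool"
  where "marot_ring R \<longleftrightarrow>
    (\<forall>I. regular_ideal R I \<longrightarrow> (\<exists>S. S \<subseteq> regular_elems R \<and> I = Idl\<^bsub>R\<^esub> S))"

definition regular_noetherian :: "('a, 'b) ring_scheme \<Rightarrow> bool"
  where "regular_noetherian R \<longleftrightarrow>
    (\<forall>I. regular_ideal R I \<longrightarrow> (\<exists>S. finite S \<and> S \<subseteq> carrier R \<and> I = Idl\<^bsub>R\<^esub> S))"


section \<open>The total quotient ring\<close>

text \<open>The class of the fraction \<open>a/s\<close>, for \<open>s\<close> regular. As the denominators are
  regular, \<open>a/s = b/t\<close> simply means \<open>a t = b s\<close>.\<close>

definition frac :: "('a, 'b) ring_scheme \<Rightarrow> 'a \<Rightarrow> 'a \<Rightarrow> ('a \<times> 'a) set"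
  where "frac R a s =
    {(b, t). b \<in> carrier R \<and> t \<in> regular_elems R \<and> a \<otimes>\<^bsub>R\<^esub> t = b \<otimes>\<^bsub>R\<^esub> s}"

text \<open>Operations on classes are unions over all representatives, as for
  \<^const>\<open>rcoset_mult\<close> on quotient rings. The record type is that of modules, so
  that the result is at once a ring and an \<open>R\<close>-module (see \<open>total_quotient_algebra\<close>
  below).\<close>

definition total_quotient :: "('a, 'b) ring_scheme \<Rightarrow> ('a, ('a \<times> 'a) set) module"
  where "total_quotient R =
    \<lparr>carrier = {frac R a s | a s. a \<in> carrier R \<and> s \<in> regular_elems R},
     mult = (\<lambda>X Y. \<Union>(a, s)\<in>X. \<Union>(b, t)\<in>Y. frac R (a \<otimes>\<^bsub>R\<^esub> b) (s \<otimes>\<^bsub>R\<^esub> t)),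
     one = frac R \<one>\<^bsub>R\<^esub> \<one>\<^bsub>R\<^esub>,
     zero = frac R \<zero>\<^bsub>R\<^esub> \<one>\<^bsub>R\<^esub>,
     add = (\<lambda>X Y. \<Union>(a, s)\<in>X. \<Union>(b, t)\<in>Y.
        frac R (a \<otimes>\<^bsub>R\<^esub> t \<oplus>\<^bsub>R\<^esub> b \<otimes>\<^bsub>R\<^esub> s) (s \<otimes>\<^bsub>R\<^esub> t)),
     smult = (\<lambda>c X. \<Union>(a, s)\<in>X. frac R (c \<otimes>\<^bsub>R\<^esub> a) s)\<rparr>"

definition tq_embed :: "('a, 'b) ring_scheme \<Rightarrow> 'a \<Rightarrow> ('a \<times> 'a) set"
  where "tq_embed R a = frac R a \<one>\<^bsub>R\<^esub>"

lemma UN1_const: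
  assumes "p \<in> X" and "\<And>a s. (a, s) \<in> X \<Longrightarrow> F a s = C"
  shows "(\<Union>(a, s)\<in>X. F a s) = C"
proof -
  have "(\<Union>(a, s)\<in>X. F a s) = (\<Union>q\<in>X. C)"
    by (rule SUP_cong) (auto simp: assms(2))
  also have "\<dots> = C" using assms(1) by auto
  finally show ?thesis .
qed

lemma UN2_const:
  assumes "p \<in> X" "q \<in> Y"
    and "\<And>a s b t. \<lbrakk>(a, s) \<in> X; (b, t) \<in> Y\<rbrakk> \<Longrightarrow> F a s b t = C"
  shows "(\<Union>(a, s)\<in>X. \<Union>(b, t)\<in>Y. F a s b t) = C"
  by (rule UN1_const[OF assms(1)], rule UN1_const[OF assms(2)], rule assms(3))

context cring
begin

lemma regular_elemsD:
  "\<lbrakk>s \<in> regular_elems R; x \<in> carrier R; s \<otimes> x = \<zero>\<rbrakk> \<Longrightarrow> x = \<zero>"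
  unfolding regular_elems_def by blast

lemma regular_elems_closed [simp]: "s \<in> regular_elems R \<Longrightarrow> s \<in> carrier R"
  unfolding regular_elems_def by blast

lemma regular_elems_one [simp]: "\<one> \<in> regular_elems R"
  unfolding regular_elems_def
proof (intro CollectI conjI ballI impI)
  show "\<one> \<in> carrier R" by (rule one_closed)
  show "x = \<zero>" if "x \<in> carrier R" "\<one> \<otimes> x = \<zero>" for x
    using that(2) unfolding l_one[OF that(1)] .
qed

lemma regular_elems_mult [simp]:
  assumes s: "s \<in> regular_elems R" and t: "t \<in> regular_elems R"
  shows "s \<otimes> t \<in> regular_elems R"
proof -
  have "x = \<zero>" if x: "x \<in> carrier R" and eq: "s \<otimes> t \<otimes> x = \<zero>" for x
  proof (rule regular_elemsD[OF t x], rule regular_elemsD[OF s])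
    show "t \<otimes> x \<in> carrier R" using t x by simp
    show "s \<otimes> (t \<otimes> x) = \<zero>"
      using eq m_assoc[OF regular_elems_closed[OF s] regular_elems_closed[OF t] x] by simp
  qed
  moreover have "s \<otimes> t \<in> carrier R" using s t by simp
  ultimately show ?thesis unfolding regular_elems_def by blast
qed

lemma regular_elems_cancel:
  assumes s: "s \<in> regular_elems R" and [simp]: "x \<in> carrier R" "y \<in> carrier R"
    and eq: "s \<otimes> x = s \<otimes> y"
  shows "x = y"
proof -
  have [simp]: "s \<in> carrier R" using s by simp
  have "s \<otimes> (x \<ominus> y) = s \<otimes> x \<ominus> s \<otimes> y"
    by (simp add: minus_eq r_distr r_minus)
  also have "\<dots> = \<zero>" using eq by (simp add: minus_eq r_neg)
  finally have "x \<ominus> y = \<zero>" by (rule regular_elemsD[OF s, rotated]) simp_all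
  then have "\<zero> \<oplus> y = (x \<ominus> y) \<oplus> y" by (simp only:)
  also have "\<dots> = x" by (simp add: minus_eq a_assoc l_neg)
  finally show ?thesis by simp
qed

lemma frac_eq_iff:
  assumes a: "a \<in> carrier R" and s: "s \<in> regular_elems R"
    and b: "b \<in> carrier R" and t: "t \<in> regular_elems R"
  shows "frac R a s = frac R b t \<longleftrightarrow> a \<otimes> t = b \<otimes> s"
proof
  assume "frac R a s = frac R b t"
  moreover have "(b, t) \<in> frac R b t" using b t by (simp add: frac_def)
  ultimately show "a \<otimes> t = b \<otimes> s" by (auto simp: frac_def)
next
  have sub: "frac R a s \<subseteq> frac R b t"
    if a: "a \<in> carrier R" and s: "s \<in> regular_elems R"
    and b: "b \<in> carrier R" and t: "t \<in> regular_elems R" and eq: "a \<otimes> t = b \<otimes> s"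
    for a s b t
  proof (clarsimp simp: frac_def)
    fix c u assume c: "c \<in> carrier R" and u: "u \<in> regular_elems R"
      and eq2: "a \<otimes> u = c \<otimes> s"
    have carr: "a \<in> carrier R" "b \<in> carrier R" "c \<in> carrier R"
      "s \<in> carrier R" "t \<in> carrier R" "u \<in> carrier R"
      using a b c s t u by simp_all
    have "s \<otimes> (b \<otimes> u) = (b \<otimes> s) \<otimes> u"
      using carr by algebra
    also have "\<dots> = (a \<otimes> t) \<otimes> u" using eq by simp
    also have "\<dots> = t \<otimes> (a \<otimes> u)" using carr by algebra
    also have "\<dots> = t \<otimes> (c \<otimes> s)" using eq2 by simp
    also have "\<dots> = s \<otimes> (c \<otimes> t)" using carr by algebra
    finally show "b \<otimes> u = c \<otimes> t"
      by (rule regular_elems_cancel[OF s m_closed[OF carr(2,6)] m_closed[OF carr(3,5)]])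
  qed
  assume eq: "a \<otimes> t = b \<otimes> s"
  show "frac R a s = frac R b t"
    by (rule subset_antisym[OF sub[OF a s b t eq] sub[OF b t a s eq[symmetric]]])
qed

lemma frac_self: "\<lbrakk>a \<in> carrier R; s \<in> regular_elems R\<rbrakk> \<Longrightarrow> (a, s) \<in> frac R a s"
  by (simp add: frac_def)

lemma frac_memD:
  assumes "a \<in> carrier R" "s \<in> regular_elems R" "(b, t) \<in> frac R a s"
  shows "b \<in> carrier R" "t \<in> regular_elems R" "a \<otimes> t = b \<otimes> s"
  using assms by (simp_all add: frac_def)

lemma tq_mult:
  assumes a: "a \<in> carrier R" and s: "s \<in> regular_elems R"
    and b: "b \<in> carrier R" and t: "t \<in> regular_elems R"
  shows "frac R a s \<otimes>\<^bsub>total_quotient R\<^esub> frac R b t = frac R (a \<otimes> b) (s \<otimes> t)"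
proof -
  have "frac R (a' \<otimes> b') (s' \<otimes> t') = frac R (a \<otimes> b) (s \<otimes> t)"
    if "(a', s') \<in> frac R a s" "(b', t') \<in> frac R b t" for a' s' b' t'
  proof -
    note A = frac_memD[OF a s that(1)] and B = frac_memD[OF b t that(2)]
    have carr: "a \<in> carrier R" "b \<in> carrier R" "s \<in> carrier R" "t \<in> carrier R"
      "a' \<in> carrier R" "b' \<in> carrier R" "s' \<in> carrier R" "t' \<in> carrier R"
      using a b s t A B by simp_all
    have "(a' \<otimes> b') \<otimes> (s \<otimes> t) = (a' \<otimes> s) \<otimes> (b' \<otimes> t)" using carr by algebra
    also have "\<dots> = (a \<otimes> s') \<otimes> (b \<otimes> t')" using A(3) B(3) by simp
    also have "\<dots> = (a \<otimes> b) \<otimes> (s' \<otimes> t')" using carr by algebra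
    finally show ?thesis using a b s t A B by (subst frac_eq_iff) simp_all
  qed
  then show ?thesis
    unfolding total_quotient_def monoid.simps ring.simps
    by (rule UN2_const[OF frac_self[OF a s] frac_self[OF b t]])
qed

lemma tq_add:
  assumes a: "a \<in> carrier R" and s: "s \<in> regular_elems R"
    and b: "b \<in> carrier R" and t: "t \<in> regular_elems R"
  shows "frac R a s \<oplus>\<^bsub>total_quotient R\<^esub> frac R b t = frac R (a \<otimes> t \<oplus> b \<otimes> s) (s \<otimes> t)"
proof -
  have "frac R (a' \<otimes> t' \<oplus> b' \<otimes> s') (s' \<otimes> t') = frac R (a \<otimes> t \<oplus> b \<otimes> s) (s \<otimes> t)"
    if "(a', s') \<in> frac R a s" "(b', t') \<in> frac R b t" for a' s' b' t'
  proof -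
    note A = frac_memD[OF a s that(1)] and B = frac_memD[OF b t that(2)]
    have carr: "a \<in> carrier R" "b \<in> carrier R" "s \<in> carrier R" "t \<in> carrier R"
      "a' \<in> carrier R" "b' \<in> carrier R" "s' \<in> carrier R" "t' \<in> carrier R"
      using a b s t A B by simp_all
    have "(a' \<otimes> t' \<oplus> b' \<otimes> s') \<otimes> (s \<otimes> t)
        = (a' \<otimes> t') \<otimes> (s \<otimes> t) \<oplus> (b' \<otimes> s') \<otimes> (s \<otimes> t)"
      using carr by (simp only: l_distr m_closed)
    also have "(a' \<otimes> t') \<otimes> (s \<otimes> t) = (a' \<otimes> s) \<otimes> (t \<otimes> t')" using carr by (simp add: m_ac)
    also have "(b' \<otimes> s') \<otimes> (s \<otimes> t) = (b' \<otimes> t) \<otimes> (s \<otimes> s')" using carr by (simp add: m_ac)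
    also have "a' \<otimes> s = a \<otimes> s'" using A(3) by simp
    also have "b' \<otimes> t = b \<otimes> t'" using B(3) by simp
    also have "(a \<otimes> s') \<otimes> (t \<otimes> t') = (a \<otimes> t) \<otimes> (s' \<otimes> t')" using carr by (simp add: m_ac)
    also have "(b \<otimes> t') \<otimes> (s \<otimes> s') = (b \<otimes> s) \<otimes> (s' \<otimes> t')" using carr by (simp add: m_ac)
    also have "(a \<otimes> t) \<otimes> (s' \<otimes> t') \<oplus> (b \<otimes> s) \<otimes> (s' \<otimes> t')
        = (a \<otimes> t \<oplus> b \<otimes> s) \<otimes> (s' \<otimes> t')"
      using carr by (simp only: l_distr m_closed)
    finally show ?thesis using a b s t A B by (subst frac_eq_iff) simp_all
  qed
  then show ?thesis
    unfolding total_quotient_def monoid.simps ring.simps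
    by (rule UN2_const[OF frac_self[OF a s] frac_self[OF b t]])
qed

lemma tq_smult:
  assumes c: "c \<in> carrier R" and a: "a \<in> carrier R" and s: "s \<in> regular_elems R"
  shows "c \<odot>\<^bsub>total_quotient R\<^esub> frac R a s = frac R (c \<otimes> a) s"
proof -
  have "frac R (c \<otimes> a') s' = frac R (c \<otimes> a) s" if "(a', s') \<in> frac R a s" for a' s'
  proof -
    note A = frac_memD[OF a s that]
    have carr: "a \<in> carrier R" "s \<in> carrier R" "a' \<in> carrier R" "s' \<in> carrier R"
      using a s A by simp_all
    show ?thesis using c a s A carr by (subst frac_eq_iff) (simp_all add: m_assoc)
  qed
  then show ?thesis
    unfolding total_quotient_def module.simps
    by (rule UN1_const[OF frac_self[OF a s]])
qed

lemma tq_one: "\<one>\<^bsub>total_quotient R\<^esub> = frac R \<one> \<one>"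
  by (simp add: total_quotient_def)

lemma tq_zero: "\<zero>\<^bsub>total_quotient R\<^esub> = frac R \<zero> \<one>"
  by (simp add: total_quotient_def)

lemma tq_carrier:
  "carrier (total_quotient R) = {frac R a s | a s. a \<in> carrier R \<and> s \<in> regular_elems R}"
  by (simp add: total_quotient_def)

lemma tq_frac_closed [simp]:
  "\<lbrakk>a \<in> carrier R; s \<in> regular_elems R\<rbrakk> \<Longrightarrow> frac R a s \<in> carrier (total_quotient R)"
  by (auto simp: tq_carrier)

lemma tq_cases:
  assumes "x \<in> carrier (total_quotient R)"
  obtains a s where "a \<in> carrier R" "s \<in> regular_elems R" "x = frac R a s"
  using assms by (auto simp: tq_carrier)

lemmas tq_ops = tq_mult tq_add tq_smult tq_one tq_zero

lemma total_quotient_cring: "cring (total_quotient R)"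
proof (rule cringI)
  let ?T = "total_quotient R"
  show "abelian_group ?T"
  proof (rule abelian_groupI)
    fix x y assume "x \<in> carrier ?T" "y \<in> carrier ?T"
    then show "x \<oplus>\<^bsub>?T\<^esub> y \<in> carrier ?T"
      by (elim tq_cases) (simp add: tq_ops)
  next
    show "\<zero>\<^bsub>?T\<^esub> \<in> carrier ?T" by (simp add: tq_ops)
  next
    fix x y z assume "x \<in> carrier ?T" "y \<in> carrier ?T" "z \<in> carrier ?T"
    then show "x \<oplus>\<^bsub>?T\<^esub> y \<oplus>\<^bsub>?T\<^esub> z = x \<oplus>\<^bsub>?T\<^esub> (y \<oplus>\<^bsub>?T\<^esub> z)"
      by (elim tq_cases) (simp add: tq_ops l_distr r_distr m_ac a_ac)
  next
    fix x y assume "x \<in> carrier ?T" "y \<in> carrier ?T"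
    then show "x \<oplus>\<^bsub>?T\<^esub> y = y \<oplus>\<^bsub>?T\<^esub> x"
      by (elim tq_cases) (simp add: tq_ops m_ac a_ac)
  next
    fix x assume "x \<in> carrier ?T"
    then show "\<zero>\<^bsub>?T\<^esub> \<oplus>\<^bsub>?T\<^esub> x = x"
      by (elim tq_cases) (simp add: tq_ops)
  next
    fix x assume "x \<in> carrier ?T"
    then obtain a s where as: "a \<in> carrier R" "s \<in> regular_elems R" "x = frac R a s"
      by (rule tq_cases)
    show "\<exists>y\<in>carrier ?T. y \<oplus>\<^bsub>?T\<^esub> x = \<zero>\<^bsub>?T\<^esub>"
    proof
      show "frac R (\<ominus> a) s \<in> carrier ?T" using as by simp
      show "frac R (\<ominus> a) s \<oplus>\<^bsub>?T\<^esub> x = \<zero>\<^bsub>?T\<^esub>"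
        using as by (simp add: tq_ops frac_eq_iff l_minus l_neg)
    qed
  qed
  show "comm_monoid ?T"
  proof (rule comm_monoidI)
    fix x y assume "x \<in> carrier ?T" "y \<in> carrier ?T"
    then show "x \<otimes>\<^bsub>?T\<^esub> y \<in> carrier ?T"
      by (elim tq_cases) (simp add: tq_ops)
  next
    show "\<one>\<^bsub>?T\<^esub> \<in> carrier ?T" by (simp add: tq_ops)
  next
    fix x y z assume "x \<in> carrier ?T" "y \<in> carrier ?T" "z \<in> carrier ?T"
    then show "x \<otimes>\<^bsub>?T\<^esub> y \<otimes>\<^bsub>?T\<^esub> z = x \<otimes>\<^bsub>?T\<^esub> (y \<otimes>\<^bsub>?T\<^esub> z)"
      by (elim tq_cases) (simp add: tq_ops m_ac)
  next
    fix x assume "x \<in> carrier ?T"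
    then show "\<one>\<^bsub>?T\<^esub> \<otimes>\<^bsub>?T\<^esub> x = x"
      by (elim tq_cases) (simp add: tq_ops)
  next
    fix x y assume "x \<in> carrier ?T" "y \<in> carrier ?T"
    then show "x \<otimes>\<^bsub>?T\<^esub> y = y \<otimes>\<^bsub>?T\<^esub> x"
      by (elim tq_cases) (simp add: tq_ops m_ac)
  qed
  show "(x \<oplus>\<^bsub>?T\<^esub> y) \<otimes>\<^bsub>?T\<^esub> z = x \<otimes>\<^bsub>?T\<^esub> z \<oplus>\<^bsub>?T\<^esub> y \<otimes>\<^bsub>?T\<^esub> z"
    if "x \<in> carrier ?T" "y \<in> carrier ?T" "z \<in> carrier ?T" for x y z
    using that
    by (elim tq_cases) (simp add: tq_ops frac_eq_iff l_distr r_distr m_ac a_ac)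
qed

theorem total_quotient_algebra: "algebra R (total_quotient R)"
proof (rule algebraI)
  let ?T = "total_quotient R"
  show "cring R" by (rule is_cring)
  show "cring ?T" by (rule total_quotient_cring)
  fix a x assume a: "a \<in> carrier R" and x: "x \<in> carrier ?T"
  show "a \<odot>\<^bsub>?T\<^esub> x \<in> carrier ?T"
    using a x by (elim tq_cases) (simp add: tq_ops)
  show "(a \<oplus> b) \<odot>\<^bsub>?T\<^esub> x = a \<odot>\<^bsub>?T\<^esub> x \<oplus>\<^bsub>?T\<^esub> b \<odot>\<^bsub>?T\<^esub> x" if "b \<in> carrier R" for b
    using a x that by (elim tq_cases) (simp add: tq_ops frac_eq_iff l_distr r_distr m_ac a_ac)
  show "(a \<otimes> b) \<odot>\<^bsub>?T\<^esub> x = a \<odot>\<^bsub>?T\<^esub> (b \<odot>\<^bsub>?T\<^esub> x)" if "b \<in> carrier R" for b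
    using a x that by (elim tq_cases) (simp add: tq_ops m_ac)
  show "a \<odot>\<^bsub>?T\<^esub> (x \<oplus>\<^bsub>?T\<^esub> y) = a \<odot>\<^bsub>?T\<^esub> x \<oplus>\<^bsub>?T\<^esub> a \<odot>\<^bsub>?T\<^esub> y" if "y \<in> carrier ?T" for y
    using a x that by (elim tq_cases) (simp add: tq_ops l_distr r_distr m_ac a_ac)
  show "a \<odot>\<^bsub>?T\<^esub> x \<otimes>\<^bsub>?T\<^esub> y = a \<odot>\<^bsub>?T\<^esub> (x \<otimes>\<^bsub>?T\<^esub> y)" if "y \<in> carrier ?T" for y
    using a x that by (elim tq_cases) (simp add: tq_ops m_ac)
next
  fix x assume "x \<in> carrier (total_quotient R)"
  then show "\<one> \<odot>\<^bsub>total_quotient R\<^esub> x = x"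
    by (elim tq_cases) (simp add: tq_ops)
qed

theorem tq_embed_hom: "tq_embed R \<in> ring_hom R (total_quotient R)"
  by (rule ring_hom_memI) (simp_all add: tq_embed_def tq_ops)

theorem tq_embed_inj: "inj_on (tq_embed R) (carrier R)"
  by (rule inj_onI) (simp add: tq_embed_def frac_eq_iff)

theorem tq_embed_Units:
  assumes s: "s \<in> regular_elems R"
  shows "tq_embed R s \<in> Units (total_quotient R)"
proof -
  have "frac R \<one> s \<otimes>\<^bsub>total_quotient R\<^esub> tq_embed R s = \<one>\<^bsub>total_quotient R\<^esub>"
    "tq_embed R s \<otimes>\<^bsub>total_quotient R\<^esub> frac R \<one> s = \<one>\<^bsub>total_quotient R\<^esub>"
    using s by (simp_all add: tq_embed_def tq_ops frac_eq_iff)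
  moreover have "frac R \<one> s \<in> carrier (total_quotient R)"
    "tq_embed R s \<in> carrier (total_quotient R)"
    using s by (simp_all add: tq_embed_def)
  ultimately show ?thesis unfolding Units_def by blast
qed

theorem frac_eq_quotient:
  assumes "a \<in> carrier R" "s \<in> regular_elems R"
  shows "frac R a s \<otimes>\<^bsub>total_quotient R\<^esub> tq_embed R s = tq_embed R a"
  using assms by (simp add: tq_embed_def tq_ops frac_eq_iff m_ac)

theorem tq_smult_eq_embed_mult:
  assumes "a \<in> carrier R" "x \<in> carrier (total_quotient R)"
  shows "a \<odot>\<^bsub>total_quotient R\<^esub> x = tq_embed R a \<otimes>\<^bsub>total_quotient R\<^esub> x"
  using assms by (elim tq_cases) (simp add: tq_embed_def tq_ops)

end


section \<open>Invertible ideals and radical ideals\<close>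

text \<open>\<^const>\<open>ideal_prod\<close> is applied in the total quotient ring to \<open>R\<close>-submodules: it
  consists of the finite sums of products of members of its two arguments.\<close>

definition invertible_ideal :: "('a, 'b) ring_scheme \<Rightarrow> 'a set \<Rightarrow> bool"
  where "invertible_ideal R J \<longleftrightarrow> ideal J R \<and>
    (\<exists>J'. submodule J' R (total_quotient R) \<and>
      ideal_prod (total_quotient R) (tq_embed R ` J) J' = tq_embed R ` carrier R)"

definition radical :: "('a, 'b) ring_scheme \<Rightarrow> 'a set \<Rightarrow> 'a set"
  where "radical R H = {x \<in> carrier R. \<exists>n::nat. 0 < n \<and> x [^]\<^bsub>R\<^esub> n \<in> H}"

text \<open>Radical ideals are proper by convention.\<close>

definition radical_ideal :: "('a, 'b) ring_scheme \<Rightarrow> 'a set \<Rightarrow> bool"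
  where "radical_ideal R H \<longleftrightarrow> ideal H R \<and> H \<noteq> carrier R \<and> radical R H = H"


section \<open>Dedekind rings, SP-rings and ISP-rings\<close>

text \<open>\<^term>\<open>carrier R\<close> is the neutral element for the product of ideals, so it is the
  empty product.\<close>

definition ideal_list_prod :: "('a, 'b) ring_scheme \<Rightarrow> 'a set list \<Rightarrow> 'a set"
  where "ideal_list_prod R Is = foldr (ideal_prod R) Is (carrier R)"

definition dedekind_ring :: "('a, 'b) ring_scheme \<Rightarrow> bool"
  where "dedekind_ring R \<longleftrightarrow>
    (\<forall>I. proper_regular_ideal R I \<longrightarrow>
      (\<exists>Ps. Ps \<noteq> [] \<and> (\<forall>P \<in> set Ps. primeideal P R) \<and> I = ideal_list_prod R Ps))"

definition SP_ring :: "('a, 'b) ring_scheme \<Rightarrow> bool"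
  where "SP_ring R \<longleftrightarrow>
    (\<forall>I. proper_regular_ideal R I \<longrightarrow>
      (\<exists>Hs. Hs \<noteq> [] \<and> (\<forall>H \<in> set Hs. radical_ideal R H) \<and> I = ideal_list_prod R Hs))"

definition ISP_ring :: "('a, 'b) ring_scheme \<Rightarrow> bool"
  where "ISP_ring R \<longleftrightarrow>
    (\<forall>I. proper_regular_ideal R I \<longrightarrow>
      (\<exists>J Hs. invertible_ideal R J \<and> Hs \<noteq> [] \<and> (\<forall>H \<in> set Hs. radical_ideal R H) \<and>
        I = ideal_prod R J (ideal_list_prod R Hs)))"

end

theory Submission
  imports Defs
begin

text \<open>For \<open>(3) \<Rightarrow> (1)\<close>, let \<open>M\<close> be a regular maximal ideal. As \<open>A\<close> is Marot and \<open>M \<noteq> M\<^sup>2\<close> by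
  Nakayama, there is a regular \<open>a \<in> M\<close> outside \<open>M\<^sup>2\<close>. Write \<open>M\<^sup>2 + (a) = HL\<close> with \<open>H\<close> radical. Then
  \<open>H = M\<close>, and \<open>L \<subseteq> M\<close> would put \<open>a\<close> in \<open>M\<^sup>2\<close>; since \<open>M\<^sup>2 \<subseteq> L\<close>, it follows that \<open>L = A\<close>, so
  \<open>M = M\<^sup>2 + (a)\<close>. Nakayama now gives \<open>(1 - m)M \<subseteq> (a)\<close> with \<open>m \<in> M\<close>, whence \<open>M\<close> is invertible.
  A regular ideal \<open>I \<subseteq> M\<close> is thus \<open>MK\<close> with \<open>K\<close> strictly larger than \<open>I\<close>, and Noetherian induction
  makes it a product of maximal ideals.

  For \<open>(1) \<Rightarrow> (2)\<close>, invertible primes of a Dedekind ring are maximal. A regular prime \<open>P\<close> contains a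
  regular \<open>r\<close>, hence a prime factor of \<open>(r)\<close>; that factor is invertible, so maximal, so equal to
  \<open>P\<close>. Therefore all regular ideals are invertible, and in particular finitely generated.\<close>

context cring
begin

section \<open>Products, sums and colons of ideals\<close>

lemma ideal_mem:
  assumes "ideal I R"
  shows "x \<in> I \<Longrightarrow> x \<in> carrier R" "\<zero> \<in> I"
    and "\<lbrakk>x \<in> I; y \<in> I\<rbrakk> \<Longrightarrow> x \<oplus> y \<in> I" "\<lbrakk>x \<in> I; y \<in> I\<rbrakk> \<Longrightarrow> x \<ominus> y \<in> I"
    and "\<lbrakk>x \<in> I; r \<in> carrier R\<rbrakk> \<Longrightarrow> r \<otimes> x \<in> I" "\<lbrakk>x \<in> I; r \<in> carrier R\<rbrakk> \<Longrightarrow> x \<otimes> r \<in> I"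
proof -
  interpret ideal I R by fact
  show "x \<in> I \<Longrightarrow> x \<in> carrier R" "\<zero> \<in> I"
    "\<lbrakk>x \<in> I; y \<in> I\<rbrakk> \<Longrightarrow> x \<oplus> y \<in> I" "\<lbrakk>x \<in> I; y \<in> I\<rbrakk> \<Longrightarrow> x \<ominus> y \<in> I"
    "\<lbrakk>x \<in> I; r \<in> carrier R\<rbrakk> \<Longrightarrow> r \<otimes> x \<in> I" "\<lbrakk>x \<in> I; r \<in> carrier R\<rbrakk> \<Longrightarrow> x \<otimes> r \<in> I"
    by (simp_all add: a_minus_def I_l_closed I_r_closed)
qed

text \<open>This is the colon ideal \<open>K : X\<close>. To show that a fixed multiplier sends a
  whole sum or product of ideals into \<open>K\<close>, it suffices to check generators, because
  what is sent into \<open>K\<close> forms this ideal.\<close>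

lemma ideal_colon:
  assumes K: "ideal K R" and X: "X \<subseteq> carrier R"
  shows "ideal {y \<in> carrier R. \<forall>x\<in>X. x \<otimes> y \<in> K} R"
proof (rule idealI[OF ring_axioms])
  have X': "\<And>x. x \<in> X \<Longrightarrow> x \<in> carrier R" using X by blast
  note Km = ideal_mem[OF K]
  show "subgroup {y \<in> carrier R. \<forall>x\<in>X. x \<otimes> y \<in> K} (add_monoid R)"
  proof (rule add.subgroupI)
    show "\<ominus> y \<in> {y \<in> carrier R. \<forall>x\<in>X. x \<otimes> y \<in> K}"
      if "y \<in> {y \<in> carrier R. \<forall>x\<in>X. x \<otimes> y \<in> K}" for y
    proof -
      have "x \<otimes> (\<ominus> y) = \<zero> \<ominus> x \<otimes> y" if "x \<in> X" "y \<in> carrier R" for x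
        using X'[OF that(1)] that(2) by (simp add: a_minus_def r_minus)
      then show ?thesis using that Km(2,4) by auto
    qed
    show "{y \<in> carrier R. \<forall>x\<in>X. x \<otimes> y \<in> K} \<noteq> {}"
    proof -
      have "\<zero> \<in> {y \<in> carrier R. \<forall>x\<in>X. x \<otimes> y \<in> K}" using X' Km(2) by simp
      then show ?thesis by blast
    qed
    show "y \<oplus> z \<in> {y \<in> carrier R. \<forall>x\<in>X. x \<otimes> y \<in> K}"
      if "y \<in> {y \<in> carrier R. \<forall>x\<in>X. x \<otimes> y \<in> K}" "z \<in> {y \<in> carrier R. \<forall>x\<in>X. x \<otimes> y \<in> K}"
      for y z
      using that X' Km(3) by (simp add: r_distr)
  qed auto
  show "r \<otimes> y \<in> {y \<in> carrier R. \<forall>x\<in>X. x \<otimes> y \<in> K}"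
    "y \<otimes> r \<in> {y \<in> carrier R. \<forall>x\<in>X. x \<otimes> y \<in> K}"
    if "y \<in> {y \<in> carrier R. \<forall>x\<in>X. x \<otimes> y \<in> K}" "r \<in> carrier R" for y r
  proof -
    have "x \<otimes> (r \<otimes> y) = r \<otimes> (x \<otimes> y)" "x \<otimes> (y \<otimes> r) = r \<otimes> (x \<otimes> y)" if "x \<in> X" for x
      using X'[OF that] \<open>r \<in> carrier R\<close> \<open>y \<in> _\<close> by (auto simp: m_ac)
    then show "r \<otimes> y \<in> {y \<in> carrier R. \<forall>x\<in>X. x \<otimes> y \<in> K}"
      "y \<otimes> r \<in> {y \<in> carrier R. \<forall>x\<in>X. x \<otimes> y \<in> K}"
      using that Km(5) by auto
  qed
qed

lemma ideal_colon_elem: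
  "\<lbrakk>ideal K R; a \<in> carrier R\<rbrakk> \<Longrightarrow> ideal {y \<in> carrier R. a \<otimes> y \<in> K} R"
  using ideal_colon[of K "{a}"] by simp

lemma ideal_prod_subset:
  assumes "ideal K R" "\<And>i j. \<lbrakk>i \<in> I; j \<in> J\<rbrakk> \<Longrightarrow> i \<otimes> j \<in> K"
  shows "I \<cdot> J \<subseteq> K"
proof
  fix z assume "z \<in> I \<cdot> J"
  then show "z \<in> K" by induct (simp_all add: assms(2) ideal_mem(3)[OF assms(1)])
qed

lemma ideal_prod_mono: "\<lbrakk>I \<subseteq> I'; J \<subseteq> J'\<rbrakk> \<Longrightarrow> I \<cdot> J \<subseteq> I' \<cdot> J'"
proof
  fix z assume "I \<subseteq> I'" "J \<subseteq> J'" "z \<in> I \<cdot> J"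
  from this(3,1,2) show "z \<in> I' \<cdot> J'"
    by induct (auto intro: ideal_prod.intros)
qed

lemma ideal_prod_sub1: "\<lbrakk>ideal I R; ideal J R\<rbrakk> \<Longrightarrow> I \<cdot> J \<subseteq> I"
  and ideal_prod_sub2: "\<lbrakk>ideal I R; ideal J R\<rbrakk> \<Longrightarrow> I \<cdot> J \<subseteq> J"
  using ideal_prod_inter by blast+

lemma ideal_prod_lcomm:
  assumes "ideal I R" "ideal J R" "ideal K R"
  shows "I \<cdot> (J \<cdot> K) = J \<cdot> (I \<cdot> K)"
  by (simp only: ideal_prod_assoc[OF assms, symmetric] ideal_prod_assoc[OF assms(2,1,3), symmetric]
      ideal_prod_commute[OF assms(1,2)])

lemma set_add_iff: "z \<in> I <+> J \<longleftrightarrow> (\<exists>i\<in>I. \<exists>j\<in>J. z = i \<oplus> j)"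
  by (auto simp: set_add_def')

lemma set_add_sub1: "\<lbrakk>ideal I R; ideal J R\<rbrakk> \<Longrightarrow> I \<subseteq> I <+> J"
  and set_add_sub2: "\<lbrakk>ideal I R; ideal J R\<rbrakk> \<Longrightarrow> J \<subseteq> I <+> J"
  by (force simp: set_add_iff dest: ideal_mem(1,2))+

lemma set_add_least: "\<lbrakk>ideal K R; I \<subseteq> K; J \<subseteq> K\<rbrakk> \<Longrightarrow> I <+> J \<subseteq> K"
  by (force simp: set_add_iff intro: ideal_mem(3))

lemma PIdl_iff: "z \<in> PIdl a \<longleftrightarrow> (\<exists>t\<in>carrier R. z = t \<otimes> a)"
  by (auto simp: cgenideal_def)

text \<open>Finite sums collapse, because the common factor \<open>a\<close> can be pulled
  out.\<close>

lemma PIdl_prod: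
  assumes a: "a \<in> carrier R" and Y: "ideal Y R"
  shows "z \<in> (PIdl a) \<cdot> Y \<longleftrightarrow> (\<exists>y\<in>Y. z = a \<otimes> y)"
proof
  assume "z \<in> (PIdl a) \<cdot> Y"
  then show "\<exists>y\<in>Y. z = a \<otimes> y"
  proof induct
    case (prod i j)
    then obtain t where t: "t \<in> carrier R" "i = t \<otimes> a" by (auto simp: PIdl_iff)
    have "j \<in> carrier R" using prod Y by (simp add: ideal_mem)
    then have "i \<otimes> j = a \<otimes> (t \<otimes> j)" using t a by (simp add: m_ac)
    then show ?case using prod t Y ideal_mem(5) by blast
  next
    case (sum s1 s2)
    then obtain y1 y2 where y: "y1 \<in> Y" "s1 = a \<otimes> y1" "y2 \<in> Y" "s2 = a \<otimes> y2" by blast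
    then have "s1 \<oplus> s2 = a \<otimes> (y1 \<oplus> y2)" using a Y by (simp add: ideal_mem r_distr)
    then show ?case using y ideal_mem(3)[OF Y] by blast
  qed
next
  assume "\<exists>y\<in>Y. z = a \<otimes> y"
  then show "z \<in> (PIdl a) \<cdot> Y" using cgenideal_self[OF a] by (auto intro: ideal_prod.prod)
qed

lemma regular_ideal_mono: "\<lbrakk>regular_ideal R I; ideal J R; I \<subseteq> J\<rbrakk> \<Longrightarrow> regular_ideal R J"
  by (auto simp: regular_ideal_def)

lemma proper_iff: "ideal I R \<Longrightarrow> I \<noteq> carrier R \<longleftrightarrow> \<one> \<notin> I"
  using ideal.one_imp_carrier by auto

section \<open>Products of lists of ideals and prime ideals above them\<close>

lemma ideal_list_prod_Nil: "ideal_list_prod R [] = carrier R"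
  and ideal_list_prod_Cons: "ideal_list_prod R (I # Is) = I \<cdot> ideal_list_prod R Is"
  by (simp_all add: ideal_list_prod_def)

lemma ideal_list_prod_ideal:
  "(\<And>I. I \<in> set Is \<Longrightarrow> ideal I R) \<Longrightarrow> ideal (ideal_list_prod R Is) R"
  by (induction Is) (simp_all add: ideal_list_prod_Nil ideal_list_prod_Cons oneideal ideal_prod_is_ideal)

lemma ideal_list_prod_remove:
  assumes "\<And>I. I \<in> set Is \<Longrightarrow> ideal I R" "I \<in> set Is"
  shows "\<exists>L. ideal L R \<and> ideal_list_prod R Is = I \<cdot> L"
  using assms
proof (induction Is)
  case (Cons J Is)
  have J: "ideal J R" and I: "ideal I R" and Is: "ideal (ideal_list_prod R Is) R"
    using Cons.prems by (auto intro: ideal_list_prod_ideal)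
  show ?case
  proof (cases "I = J")
    case True
    then show ?thesis using Is by (auto simp: ideal_list_prod_Cons)
  next
    case False
    then obtain L where L: "ideal L R" "ideal_list_prod R Is = I \<cdot> L"
      using Cons by auto
    then have "ideal_list_prod R (J # Is) = I \<cdot> (J \<cdot> L)"
      using ideal_prod_lcomm[OF J I] by (simp add: ideal_list_prod_Cons)
    then show ?thesis using ideal_prod_is_ideal[OF J] L(1) by blast
  qed
qed simp

lemma primeideal_prod_subset:
  assumes P: "primeideal P R" and I: "ideal I R" and J: "ideal J R" and sub: "I \<cdot> J \<subseteq> P"
  shows "I \<subseteq> P \<or> J \<subseteq> P"
proof (rule ccontr)
  assume "\<not> ?thesis"
  then obtain i j where ij: "i \<in> I" "i \<notin> P" "j \<in> J" "j \<notin> P" by blast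
  moreover have "i \<otimes> j \<in> P" using ij sub by (blast intro: ideal_prod.prod)
  ultimately show False
    using primeideal.I_prime[OF P] ideal_mem(1)[OF I] ideal_mem(1)[OF J] by blast
qed

lemma primeideal_list_prod_subset:
  assumes P: "primeideal P R" and Is: "\<And>I. I \<in> set Is \<Longrightarrow> ideal I R"
    and sub: "ideal_list_prod R Is \<subseteq> P"
  shows "\<exists>I\<in>set Is. I \<subseteq> P"
  using Is sub
proof (induction Is)
  case Nil
  then have "P = carrier R"
    using ideal_mem(1)[OF primeideal.axioms(1)[OF P]] by (auto simp: ideal_list_prod_Nil)
  then show ?case using primeideal.I_notcarr[OF P] by simp
next
  case (Cons J Is)
  have "ideal J R" "ideal (ideal_list_prod R Is) R"
    using Cons.prems by (auto intro: ideal_list_prod_ideal)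
  then show ?case
    using primeideal_prod_subset[OF P] Cons by (auto simp: ideal_list_prod_Cons)
qed

section \<open>Invertible ideals\<close>

text \<open>In terms of the total quotient ring this says that \<open>I\<close> is invertible, with inverse
  \<open>r\<^sup>-\<^sup>1J\<close>; clearing the denominator keeps all computations among ideals of \<open>R\<close>.\<close>

definition divides_regular :: "'a set \<Rightarrow> bool"
  where "divides_regular I \<longleftrightarrow>
    ideal I R \<and> (\<exists>J r. ideal J R \<and> r \<in> regular_elems R \<and> I \<cdot> J = PIdl r)"

lemma divides_regular_ideal: "divides_regular I \<Longrightarrow> ideal I R"
  by (simp add: divides_regular_def)

lemma divides_regular_imp_regular: "divides_regular I \<Longrightarrow> regular_ideal R I"
proof -
  assume "divides_regular I"
  then obtain J r where J: "ideal I R" "ideal J R" "r \<in> regular_elems R" "I \<cdot> J = PIdl r"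
    by (auto simp: divides_regular_def)
  then have "r \<in> I" using ideal_prod_sub1[OF J(1,2)] cgenideal_self[of r] by auto
  then show ?thesis using J by (auto simp: regular_ideal_def)
qed

lemma divides_regular_PIdl: "r \<in> regular_elems R \<Longrightarrow> divides_regular (PIdl r)"
  unfolding divides_regular_def
  using cgenideal_ideal[of r] oneideal ideal_prod_one[of "PIdl r"] by auto

text \<open>The other factor moves into the cofactor: if \<open>IJK = rR\<close>, then
  \<open>JK\<close> is a cofactor of \<open>I\<close>.\<close>

lemma divides_regular_factor:
  assumes I: "ideal I R" and J: "ideal J R" and "divides_regular (I \<cdot> J)"
  shows "divides_regular I"
proof -
  obtain K r where K: "ideal K R" "r \<in> regular_elems R" "(I \<cdot> J) \<cdot> K = PIdl r"
    using assms(3) by (auto simp: divides_regular_def)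
  then have "I \<cdot> (J \<cdot> K) = PIdl r" using ideal_prod_assoc[OF I J] by simp
  then show ?thesis
    using I K ideal_prod_is_ideal[OF J K(1)] unfolding divides_regular_def by blast
qed

lemma PIdl_prod_PIdl:
  assumes "a \<in> carrier R" "b \<in> carrier R"
  shows "(PIdl a) \<cdot> (PIdl b) = PIdl (a \<otimes> b)"
proof -
  have "(\<exists>y\<in>PIdl b. z = a \<otimes> y) \<longleftrightarrow> (\<exists>t\<in>carrier R. z = t \<otimes> (a \<otimes> b))" for z
    using assms by (simp add: PIdl_iff Bex_def ex_simps[symmetric] m_lcomm cong: conj_cong)
  then show ?thesis
    using assms by (simp add: set_eq_iff PIdl_prod cgenideal_ideal PIdl_iff)
qed

lemma divides_regular_mult:
  assumes "divides_regular I" "divides_regular J"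
  shows "divides_regular (I \<cdot> J)"
proof -
  obtain I' r where I: "ideal I R" "ideal I' R" "r \<in> regular_elems R" "I \<cdot> I' = PIdl r"
    using assms(1) by (auto simp: divides_regular_def)
  obtain J' s where J: "ideal J R" "ideal J' R" "s \<in> regular_elems R" "J \<cdot> J' = PIdl s"
    using assms(2) by (auto simp: divides_regular_def)
  have "(I \<cdot> J) \<cdot> (I' \<cdot> J') = I \<cdot> (J \<cdot> (I' \<cdot> J'))"
    by (intro ideal_prod_assoc ideal_prod_is_ideal I J)
  also have "J \<cdot> (I' \<cdot> J') = I' \<cdot> (J \<cdot> J')"
    by (intro ideal_prod_lcomm I J)
  also have "I \<cdot> (I' \<cdot> (J \<cdot> J')) = (I \<cdot> I') \<cdot> (J \<cdot> J')"
    by (intro ideal_prod_assoc[symmetric] ideal_prod_is_ideal I J)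
  also have "\<dots> = PIdl (r \<otimes> s)" using I J by (simp add: PIdl_prod_PIdl)
  finally show ?thesis
    using ideal_prod_is_ideal[OF I(1) J(1)] ideal_prod_is_ideal[OF I(2) J(2)]
      regular_elems_mult[OF I(3) J(3)]
    unfolding divides_regular_def by blast
qed

lemma PIdl_prod_cancel:
  assumes r: "r \<in> regular_elems R" and X: "ideal X R" and Y: "ideal Y R"
    and sub: "(PIdl r) \<cdot> X \<subseteq> (PIdl r) \<cdot> Y"
  shows "X \<subseteq> Y"
proof
  fix x assume x: "x \<in> X"
  have rc: "r \<in> carrier R" using r by simp
  have "r \<otimes> x \<in> (PIdl r) \<cdot> X" using x PIdl_prod[OF rc X] by blast
  then obtain y where y: "y \<in> Y" "r \<otimes> x = r \<otimes> y" using sub PIdl_prod[OF rc Y] by blast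
  then have "x = y"
    using regular_elems_cancel[OF r] x ideal_mem(1)[OF X] ideal_mem(1)[OF Y] by blast
  then show "x \<in> Y" using y by simp
qed

text \<open>Multiplying by the cofactor of \<open>I\<close> replaces \<open>I\<close> by
  \<open>PIdl r\<close>, and a regular element cancels.\<close>

lemma divides_regular_cancel:
  assumes I: "divides_regular I" and X: "ideal X R" and Y: "ideal Y R"
    and sub: "I \<cdot> X \<subseteq> I \<cdot> Y"
  shows "X \<subseteq> Y"
proof -
  obtain J r where J: "ideal I R" "ideal J R" "r \<in> regular_elems R" "I \<cdot> J = PIdl r"
    using I by (auto simp: divides_regular_def)
  have "(PIdl r) \<cdot> Z = J \<cdot> (I \<cdot> Z)" if "ideal Z R" for Z
    using J that by (metis ideal_prod_assoc ideal_prod_commute)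
  then have "(PIdl r) \<cdot> X \<subseteq> (PIdl r) \<cdot> Y" using X Y sub by (simp add: ideal_prod_mono)
  then show ?thesis by (rule PIdl_prod_cancel[OF J(3) X Y])
qed

text \<open>For invertible ideals, to contain is to divide.\<close>

lemma divides_regular_divides:
  assumes I: "divides_regular I" and X: "ideal X R" and sub: "X \<subseteq> I"
  shows "\<exists>K. ideal K R \<and> X = I \<cdot> K"
proof -
  obtain J r where J: "ideal I R" "ideal J R" "r \<in> regular_elems R" "I \<cdot> J = PIdl r"
    using I by (auto simp: divides_regular_def)
  have r: "r \<in> carrier R" using J by simp
  \<comment> \<open>In the total quotient ring this is \<open>r\<^sup>-\<^sup>1XJ\<close>, which is
    \<open>X\<close> times the inverse of \<open>I\<close>.\<close>
  define K where "K = {k \<in> carrier R. r \<otimes> k \<in> X \<cdot> J}"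
  have K: "ideal K R"
    unfolding K_def by (intro ideal_colon_elem ideal_prod_is_ideal X J r)
  have "X \<cdot> J \<subseteq> PIdl r" using ideal_prod_mono[OF sub order_refl, of J] J by simp
  have "X \<cdot> J = (PIdl r) \<cdot> K"
  proof (intro equalityI subsetI)
    fix z assume z: "z \<in> X \<cdot> J"
    then obtain t where t: "t \<in> carrier R" "z = t \<otimes> r"
      using \<open>X \<cdot> J \<subseteq> PIdl r\<close> PIdl_iff by blast
    then have "z = r \<otimes> t" "t \<in> K" using z r by (simp_all add: K_def m_comm)
    then show "z \<in> (PIdl r) \<cdot> K" unfolding PIdl_prod[OF r K] by blast
  next
    fix z assume "z \<in> (PIdl r) \<cdot> K"
    then show "z \<in> X \<cdot> J" unfolding PIdl_prod[OF r K] by (auto simp: K_def)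
  qed
  then have "(PIdl r) \<cdot> (I \<cdot> K) = I \<cdot> (X \<cdot> J)"
    using ideal_prod_lcomm[OF cgenideal_ideal[OF r] J(1) K] by simp
  also have "\<dots> = (PIdl r) \<cdot> X"
    using ideal_prod_lcomm[OF J(1) X J(2)] J(4) ideal_prod_commute[OF X cgenideal_ideal[OF r]]
    by simp
  finally have "I \<cdot> K = X"
    using PIdl_prod_cancel[OF J(3)] X ideal_prod_is_ideal[OF J(1) K] by blast
  then show ?thesis using K by blast
qed

text \<open>A finite sum of products involves only finitely many elements of \<open>I\<close>. This
  is the source of finite generating sets for invertible ideals.\<close>

lemma ideal_prod_mem_finite:
  assumes "z \<in> I \<cdot> J"
  shows "\<exists>S. finite S \<and> S \<subseteq> I \<and> z \<in> (Idl S) \<cdot> J"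
  using assms
proof induct
  case (prod i j)
  have "i \<otimes> j \<in> (Idl {i}) \<cdot> J"
    using prod by (intro ideal_prod.prod) (auto simp: genideal_def)
  then show ?case using prod by (intro exI[of _ "{i}"]) simp
next
  case (sum s1 s2)
  then obtain S T where S: "finite S" "S \<subseteq> I" "s1 \<in> (Idl S) \<cdot> J"
    and T: "finite T" "T \<subseteq> I" "s2 \<in> (Idl T) \<cdot> J" by blast
  have "Idl S \<subseteq> Idl (S \<union> T)" "Idl T \<subseteq> Idl (S \<union> T)" by (auto simp: genideal_def)
  then have "s1 \<oplus> s2 \<in> (Idl (S \<union> T)) \<cdot> J"
    by (intro ideal_prod.sum subsetD[OF ideal_prod_mono[OF _ order_refl] S(3)]
        subsetD[OF ideal_prod_mono[OF _ order_refl] T(3)])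
  then show ?case using S T by (intro exI[of _ "S \<union> T"]) simp
qed

text \<open>If \<open>r\<close> is a combination of \<open>S \<subseteq> I\<close> with coefficients in \<open>J\<close>, then
  \<open>IJ = rR \<subseteq> (S)J\<close>, and \<open>J\<close> can be cancelled.\<close>

lemma divides_regular_finitely_generated:
  assumes "divides_regular I"
  shows "\<exists>S. finite S \<and> S \<subseteq> carrier R \<and> I = Idl S"
proof -
  obtain J r where J: "ideal I R" "ideal J R" "r \<in> regular_elems R" "I \<cdot> J = PIdl r"
    using assms by (auto simp: divides_regular_def)
  have r: "r \<in> carrier R" using J by simp
  obtain S where S: "finite S" "S \<subseteq> I" "r \<in> (Idl S) \<cdot> J"
    using ideal_prod_mem_finite[of r I J] cgenideal_self[OF r] J by auto
  have Sc: "S \<subseteq> carrier R" using S ideal_mem(1)[OF J(1)] by blast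
  have IS: "ideal (Idl S) R" by (rule genideal_ideal[OF Sc])
  have "I \<cdot> J \<subseteq> (Idl S) \<cdot> J"
    using J S cgenideal_minimal[OF ideal_prod_is_ideal[OF IS J(2)]] by simp
  then have "J \<cdot> I \<subseteq> J \<cdot> (Idl S)" using J IS by (simp add: ideal_prod_commute)
  \<comment> \<open>The cofactor is invertible too, being a factor of \<open>PIdl r\<close>, so it
    can be cancelled.\<close>
  moreover have "divides_regular J"
    using divides_regular_factor[OF J(2,1)] divides_regular_PIdl J by (simp add: ideal_prod_commute)
  ultimately have "I \<subseteq> Idl S" using divides_regular_cancel J IS by blast
  moreover have "Idl S \<subseteq> I" by (rule genideal_minimal[OF J(1) S(2)])
  ultimately show ?thesis using S Sc by blast
qed

section \<open>Regular-Noetherian rings\<close>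

lemma regular_noetherianE:
  assumes "regular_noetherian R" "regular_ideal R I"
  obtains S where "finite S" "S \<subseteq> carrier R" "I = Idl S"
  using assms unfolding regular_noetherian_def by meson

text \<open>By Zorn's lemma: the union of a chain is a regular ideal, its finitely many generators
  already lie in one member of the chain, and so it equals that member.\<close>

lemma regular_noetherian_maximal:
  assumes noeth: "regular_noetherian R" and "F \<noteq> {}" and reg: "\<And>I. I \<in> F \<Longrightarrow> regular_ideal R I"
  shows "\<exists>M\<in>F. \<forall>I\<in>F. M \<subseteq> I \<longrightarrow> I = M"
proof (rule subset_Zorn_nonempty[OF \<open>F \<noteq> {}\<close>])
  fix C assume "C \<noteq> {}" and C: "subset.chain F C"
  then have CF: "C \<subseteq> F" by (simp add: subset_chain_def)
  have id: "ideal I R" if "I \<in> C" for I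
    using reg CF that by (auto simp: regular_ideal_def)
  obtain I0 where I0: "I0 \<in> C" using \<open>C \<noteq> {}\<close> by blast
  have "ideal (\<Union>C) R"
  proof (rule idealI[OF ring_axioms])
    show "subgroup (\<Union>C) (add_monoid R)"
    proof (rule add.subgroupI)
      show "\<Union>C \<subseteq> carrier R" using ideal_mem(1)[OF id] by (intro Union_least subsetI)
      show "\<Union>C \<noteq> {}" using ideal_mem(2)[OF id[OF I0]] I0 by blast
      show "\<ominus> x \<in> \<Union>C" if "x \<in> \<Union>C" for x
        using that by (auto intro: additive_subgroup.a_inv_closed[OF ideal.axioms(1)[OF id]])
      show "x \<oplus> y \<in> \<Union>C" if x: "x \<in> \<Union>C" and y: "y \<in> \<Union>C" for x y
      proof -
        obtain I where I: "I \<in> C" "x \<in> I" using x by (rule UnionE)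
        obtain J where J: "J \<in> C" "y \<in> J" using y by (rule UnionE)
        have "I \<subseteq> J \<or> J \<subseteq> I" using C I(1) J(1) by (simp add: subset_chain_def)
        then obtain K where K: "K \<in> C" "x \<in> K" "y \<in> K" using I J by blast
        show ?thesis using ideal_mem(3)[OF id[OF K(1)] K(2,3)] K(1) by (rule UnionI[rotated])
      qed
    qed
    show "r \<otimes> x \<in> \<Union>C" "x \<otimes> r \<in> \<Union>C" if "x \<in> \<Union>C" "r \<in> carrier R" for x r
      using that by (auto intro: ideal_mem(5,6)[OF id])
  qed
  then have regU: "regular_ideal R (\<Union>C)"
    using regular_ideal_mono[of I0 "\<Union>C"] reg CF I0 by blast
  with noeth obtain S where S: "finite S" "S \<subseteq> carrier R" "\<Union>C = Idl S"
    by (rule regular_noetherianE)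
  have "S \<subseteq> \<Union>C" unfolding S(3) by (rule genideal_self[OF S(2)])
  with S(1) obtain B where B: "B \<in> C" "S \<subseteq> B"
    using \<open>C \<noteq> {}\<close> C by (rule finite_subset_Union_chain)
  have "\<Union>C \<subseteq> B" unfolding S(3) by (rule genideal_minimal[OF id[OF B(1)] B(2)])
  then have "\<Union>C = B" using B(1) by blast
  then show "\<Union>C \<in> F" using B(1) CF by blast
qed

text \<open>Every ideal above a regular ideal is regular, so an ideal maximal among the proper
  regular ones over \<open>I\<close> is maximal among all proper ideals.\<close>

lemma regular_noetherian_maximalideal:
  assumes noeth: "regular_noetherian R" and I: "proper_regular_ideal R I"
  shows "\<exists>M. maximalideal M R \<and> regular_ideal R M \<and> I \<subseteq> M"
proof -
  define F where "F = {J. proper_regular_ideal R J \<and> I \<subseteq> J}"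
  have neF: "F \<noteq> {}" using I by (auto simp: F_def)
  have regF: "\<And>J. J \<in> F \<Longrightarrow> regular_ideal R J"
    by (auto simp: F_def proper_regular_ideal_def)
  obtain M where M: "M \<in> F" and max: "\<And>J. \<lbrakk>J \<in> F; M \<subseteq> J\<rbrakk> \<Longrightarrow> J = M"
    using regular_noetherian_maximal[OF noeth neF regF] by blast
  have regM: "regular_ideal R M" and idM: "ideal M R" and neM: "carrier R \<noteq> M" and IM: "I \<subseteq> M"
    using M by (auto simp: F_def proper_regular_ideal_def regular_ideal_def)
  have "maximalideal M R"
  proof (rule maximalidealI[OF idM neM])
    fix J assume J: "ideal J R" "M \<subseteq> J"
    then have "J \<in> F" if "J \<noteq> carrier R"
      using that regular_ideal_mono[OF regM] IM by (auto simp: F_def proper_regular_ideal_def)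
    then show "J = M \<or> J = carrier R" using max[OF _ J(2)] by blast
  qed
  then show ?thesis using regM IM by blast
qed

lemma maximalideal_add:
  assumes M: "maximalideal M R" and I: "ideal I R" and "\<not> I \<subseteq> M"
  shows "I <+> M = carrier R"
proof -
  have idM: "ideal M R" using M by (rule maximalideal.axioms)
  have "I \<subseteq> I <+> M" "M \<subseteq> I <+> M"
    using set_add_sub1[OF I idM] set_add_sub2[OF I idM] by blast+
  moreover have "I <+> M \<subseteq> carrier R"
    using add_ideals[OF I idM] ideal_mem(1) by blast
  ultimately show ?thesis
    using maximalideal.I_maximal[OF M add_ideals[OF I idM]] assms(3) by blast
qed

text \<open>The generators are absorbed into \<open>B\<close> one at a time,
  which avoids determinants.\<close>

lemma nakayama:
  assumes "finite S" and M: "ideal M R" and I: "ideal I R" and "ideal B R" and "S \<subseteq> I"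
    and "\<And>K. \<lbrakk>ideal K R; S \<subseteq> K; B \<subseteq> K\<rbrakk> \<Longrightarrow> I \<subseteq> K"
    and "I \<subseteq> M \<cdot> I <+> B"
  shows "\<exists>m\<in>M. \<forall>x\<in>I. (\<one> \<ominus> m) \<otimes> x \<in> B"
  using assms(1,4-7)
proof (induction S arbitrary: B)
  case empty
  \<comment> \<open>The generation hypothesis is relative to \<open>B\<close>: with no generators
    left it says that \<open>I\<close> lies in \<open>B\<close>, and \<open>m = \<zero>\<close>
    works.\<close>
  have "I \<subseteq> B" using empty by blast
  moreover have "(\<one> \<ominus> \<zero>) \<otimes> x = x" if "x \<in> I" for x
    using ideal_mem(1)[OF I that] by (simp add: a_minus_def)
  ultimately show ?case using ideal_mem(2)[OF M] by (intro bexI[of _ \<zero>]) auto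
next
  case (insert x S)
  note B = \<open>ideal B R\<close>
  have xI: "x \<in> I" and x: "x \<in> carrier R" using insert ideal_mem(1)[OF I] by auto
  have px: "ideal (PIdl x) R" by (rule cgenideal_ideal[OF x])
  \<comment> \<open>Adjoining \<open>x\<close> to \<open>B\<close> removes it from the generators;
    the induction hypothesis then gives \<open>e = \<one> \<ominus> m\<close> with \<open>eI\<close>
    inside \<open>B + (x)\<close>.\<close>
  define B' where "B' = B <+>\<^bsub>R\<^esub> PIdl x"
  have B': "ideal B' R" unfolding B'_def by (rule add_ideals[OF B px])
  have BB': "B \<subseteq> B'" "PIdl x \<subseteq> B'"
    unfolding B'_def using set_add_sub1[OF B px] set_add_sub2[OF B px] by blast+
  have MI: "ideal (M \<cdot> I) R" by (rule ideal_prod_is_ideal[OF M I])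
  have "\<exists>m\<in>M. \<forall>y\<in>I. (\<one> \<ominus> m) \<otimes> y \<in> B'"
  proof (rule insert.IH[OF B'])
    show "S \<subseteq> I" using insert.prems by blast
    show "I \<subseteq> K" if "ideal K R" "S \<subseteq> K" "B' \<subseteq> K" for K
      using insert.prems(3)[of K] that BB' cgenideal_self[OF x] by blast
    show "I \<subseteq> M \<cdot> I <+>\<^bsub>R\<^esub> B'"
      using insert.prems(4) BB'(1) by (force simp: set_add_def')
  qed
  then obtain m where m: "m \<in> M" and mI: "\<And>y. y \<in> I \<Longrightarrow> (\<one> \<ominus> m) \<otimes> y \<in> B'" by blast
  have mc: "m \<in> carrier R" using ideal_mem(1)[OF M m] .
  define e where "e = \<one> \<ominus> m"
  have e: "e \<in> carrier R" using mc by (simp add: e_def)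
  \<comment> \<open>\<open>N\<close> is \<open>xM + B\<close>. Multiplication by \<open>e\<close>
    sends both \<open>MI\<close> and \<open>B\<close> into it, hence also \<open>x\<close>, which
    lies in \<open>MI + B\<close>.\<close>
  define N where "N = {t. \<exists>k\<in>M. \<exists>b\<in>B. t = k \<otimes> x \<oplus> b}"
  have N: "N = (PIdl x) \<cdot> M <+>\<^bsub>R\<^esub> B"
  proof (intro equalityI subsetI)
    fix t assume "t \<in> N"
    then obtain k b where kb: "k \<in> M" "b \<in> B" "t = k \<otimes> x \<oplus> b" by (auto simp: N_def)
    then have "k \<otimes> x = x \<otimes> k" using m_comm[OF ideal_mem(1)[OF M] x] by blast
    then show "t \<in> (PIdl x) \<cdot> M <+>\<^bsub>R\<^esub> B"
      using kb PIdl_prod[OF x M, of "k \<otimes> x"] by (auto simp: set_add_iff)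
  next
    fix t assume "t \<in> (PIdl x) \<cdot> M <+>\<^bsub>R\<^esub> B"
    then obtain k b where kb: "k \<in> M" "b \<in> B" "t = x \<otimes> k \<oplus> b"
      by (auto simp: set_add_iff PIdl_prod[OF x M])
    then have "k \<in> carrier R" "b \<in> carrier R" using ideal_mem(1)[OF M] ideal_mem(1)[OF B] by auto
    then show "t \<in> N" using kb x by (auto simp: N_def m_comm)
  qed
  have idN: "ideal N R" unfolding N by (intro add_ideals ideal_prod_is_ideal px M B)
  have BN: "B \<subseteq> N"
    unfolding N by (rule set_add_sub2[OF ideal_prod_is_ideal[OF px M] B])
  have "M \<cdot> I \<subseteq> {y \<in> carrier R. e \<otimes> y \<in> N}"
  proof (rule ideal_prod_subset[OF ideal_colon_elem[OF idN e]])
    fix k y assume k: "k \<in> M" and y: "y \<in> I"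
    have kc: "k \<in> carrier R" and yc: "y \<in> carrier R"
      using ideal_mem(1)[OF M k] ideal_mem(1)[OF I y] .
    obtain b t where bt: "b \<in> B" "t \<in> carrier R" "e \<otimes> y = b \<oplus> t \<otimes> x"
      using mI[OF y] by (auto simp: e_def B'_def set_add_iff PIdl_iff)
    have bc: "b \<in> carrier R" using ideal_mem(1)[OF B bt(1)] .
    have "e \<otimes> (k \<otimes> y) = k \<otimes> (e \<otimes> y)" using e kc yc by (simp add: m_lcomm)
    also have "\<dots> = (k \<otimes> t) \<otimes> x \<oplus> k \<otimes> b"
      unfolding bt(3) using kc bc bt(2) x by (simp add: r_distr m_assoc a_comm)
    finally have "e \<otimes> (k \<otimes> y) = (k \<otimes> t) \<otimes> x \<oplus> k \<otimes> b" .
    moreover have "k \<otimes> t \<in> M" "k \<otimes> b \<in> B"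
      using ideal_mem(6)[OF M k bt(2)] ideal_mem(5)[OF B bt(1) kc] .
    ultimately have "e \<otimes> (k \<otimes> y) \<in> N" unfolding N_def by blast
    then show "k \<otimes> y \<in> {y \<in> carrier R. e \<otimes> y \<in> N}" using kc yc by simp
  qed
  moreover have "B \<subseteq> {y \<in> carrier R. e \<otimes> y \<in> N}"
    using BN ideal_mem(1,5)[OF B] e by blast
  ultimately have "M \<cdot> I <+> B \<subseteq> {y \<in> carrier R. e \<otimes> y \<in> N}"
    by (rule set_add_least[OF ideal_colon_elem[OF idN e]])
  then have "e \<otimes> x \<in> N" using xI insert.prems(4) by blast
  then obtain k b where kb: "k \<in> M" "b \<in> B" "e \<otimes> x = k \<otimes> x \<oplus> b" by (auto simp: N_def)
  have kc: "k \<in> carrier R" and bc: "b \<in> carrier R"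
    using ideal_mem(1)[OF M kb(1)] ideal_mem(1)[OF B kb(2)] .
  \<comment> \<open>Now \<open>f\<close> sends \<open>x\<close> into \<open>B\<close>, hence all of
    \<open>B'\<close> into \<open>B\<close>, and so \<open>f \<otimes> e\<close> sends
    \<open>I\<close> into \<open>B\<close>.\<close>
  define f where "f = e \<ominus> k"
  have f: "f \<in> carrier R" using e kc by (simp add: f_def)
  have "f \<otimes> x = e \<otimes> x \<ominus> k \<otimes> x"
    using e kc x by (simp add: f_def a_minus_def l_distr l_minus)
  also have "\<dots> = b" unfolding kb(3) using kc x bc by algebra
  finally have fx: "f \<otimes> x \<in> B" using kb by simp
  have "B' \<subseteq> {y \<in> carrier R. f \<otimes> y \<in> B}"
    unfolding B'_def
  proof (rule set_add_least[OF ideal_colon_elem[OF B f]])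
    show "B \<subseteq> {y \<in> carrier R. f \<otimes> y \<in> B}" using ideal_mem(1,5)[OF B] f by blast
    show "PIdl x \<subseteq> {y \<in> carrier R. f \<otimes> y \<in> B}"
      using cgenideal_minimal[OF ideal_colon_elem[OF B f]] fx x by blast
  qed
  then have "f \<otimes> (e \<otimes> y) \<in> B" if "y \<in> I" for y
    using mI[OF that] by (auto simp: e_def)
  \<comment> \<open>Expanding \<open>(e - k)e\<close> with \<open>e = 1 - m\<close> gives
    \<open>1 - n\<close> for this \<open>n\<close>.\<close>
  moreover define n where "n = m \<oplus> (m \<oplus> k) \<otimes> e"
  have "n \<in> M"
    unfolding n_def using m kb(1) e by (intro ideal_mem(3,6)[OF M])
  moreover have "\<one> \<ominus> n = f \<otimes> e"
    unfolding n_def f_def e_def using mc kc by algebra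
  ultimately show ?case
    using e f ideal_mem(1)[OF I] by (intro bexI[of _ n]) (simp_all add: m_assoc)
qed

corollary nakayama_generated:
  assumes S: "finite S" "S \<subseteq> carrier R" and M: "ideal M R" and B: "ideal B R"
    and sub: "Idl S \<subseteq> M \<cdot> (Idl S) <+> B"
  shows "\<exists>m\<in>M. \<forall>x\<in>Idl S. (\<one> \<ominus> m) \<otimes> x \<in> B"
  by (rule nakayama[OF S(1) M genideal_ideal[OF S(2)] B genideal_self[OF S(2)] _ sub])
    (rule genideal_minimal)

text \<open>Nakayama with \<open>B = {\<zero>}\<close>: some \<open>\<one> \<ominus> m\<close> with
  \<open>m \<in> M\<close> kills \<open>I\<close>, which contains a regular element, so
  \<open>m = \<one>\<close>.\<close>

corollary regular_ideal_neq_prod: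
  assumes noeth: "regular_noetherian R" and I: "regular_ideal R I"
    and M: "ideal M R" "M \<noteq> carrier R"
  shows "\<not> I \<subseteq> M \<cdot> I"
proof
  assume sub: "I \<subseteq> M \<cdot> I"
  obtain S where S: "finite S" "S \<subseteq> carrier R" "I = Idl S"
    using noeth I by (rule regular_noetherianE)
  have idI: "ideal I R" using I by (simp add: regular_ideal_def)
  have "M \<cdot> I \<subseteq> M \<cdot> I <+> {\<zero>}"
    by (rule set_add_sub1[OF ideal_prod_is_ideal[OF M(1) idI] zeroideal])
  then obtain m where m: "m \<in> M" "\<And>x. x \<in> I \<Longrightarrow> (\<one> \<ominus> m) \<otimes> x = \<zero>"
    using nakayama_generated[OF S(1,2) M(1) zeroideal] sub S(3) by blast
  obtain r where r: "r \<in> I" "r \<in> regular_elems R" using I by (auto simp: regular_ideal_def)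
  have mc: "m \<in> carrier R" using ideal_mem(1)[OF M(1) m(1)] .
  have "r \<otimes> (\<one> \<ominus> m) = \<zero>" using m(2)[OF r(1)] r(2) mc by (simp add: m_comm)
  then have "\<one> \<ominus> m = \<zero>" using regular_elemsD[OF r(2)] mc by simp
  moreover have "m = \<one> \<ominus> (\<one> \<ominus> m)" using mc by algebra
  ultimately have "m = \<one>" by (simp add: a_minus_def)
  then show False using m(1) proper_iff[OF M(1)] M(2) by simp
qed

section \<open>From radical factors to prime factorizations\<close>

lemma maximalideal_divides_regular:
  assumes marot: "marot_ring R" and noeth: "regular_noetherian R"
    and fact: "\<And>I. proper_regular_ideal R I \<Longrightarrow>
      \<exists>H L. radical_ideal R H \<and> ideal L R \<and> I = H \<cdot> L"
    and M: "maximalideal M R" and reg: "regular_ideal R M"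
  shows "divides_regular M"
proof -
  have idM: "ideal M R" and neM: "M \<noteq> carrier R"
    using M maximalideal.axioms(1) maximalideal.I_notcarr by blast+
  have MM: "ideal (M \<cdot> M) R" by (rule ideal_prod_is_ideal[OF idM idM])
  obtain T where T: "T \<subseteq> regular_elems R" "M = Idl T"
    using marot reg unfolding marot_ring_def by blast
  have "\<not> T \<subseteq> M \<cdot> M"
    using regular_ideal_neq_prod[OF noeth reg idM neM] genideal_minimal[OF MM] T(2) by blast
  then obtain a where aT: "a \<in> T" and a2: "a \<notin> M \<cdot> M" by blast
  have a: "a \<in> regular_elems R" and ac: "a \<in> carrier R" using aT T(1) by auto
  have aM: "a \<in> M" using aT T by (auto simp: genideal_def)
  have pa: "ideal (PIdl a) R" by (rule cgenideal_ideal[OF ac])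
  define I where "I = M \<cdot> M <+>\<^bsub>R\<^esub> PIdl a"
  have idI: "ideal I R" unfolding I_def by (rule add_ideals[OF MM pa])
  have M2I: "M \<cdot> M \<subseteq> I" and paI: "PIdl a \<subseteq> I"
    unfolding I_def using set_add_sub1[OF MM pa] set_add_sub2[OF MM pa] .
  have aI: "a \<in> I" using paI cgenideal_self[OF ac] by blast
  have IM: "I \<subseteq> M"
    unfolding I_def using ideal_prod_sub1[OF idM idM] cgenideal_minimal[OF idM aM]
    by (intro set_add_least[OF idM])
  have "I \<noteq> carrier R" using IM neM ideal_mem(1)[OF idM] by blast
  then have "proper_regular_ideal R I"
    using idI aI a by (auto simp: proper_regular_ideal_def regular_ideal_def)
  then obtain H L where H: "radical_ideal R H" and L: "ideal L R" and IHL: "I = H \<cdot> L"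
    using fact by blast
  have idH: "ideal H R" "H \<noteq> carrier R" "radical R H = H"
    using H by (auto simp: radical_ideal_def)
  have IH: "I \<subseteq> H" and IL: "I \<subseteq> L"
    unfolding IHL using ideal_prod_sub1[OF idH(1) L] ideal_prod_sub2[OF idH(1) L] .
  have "M \<subseteq> H"
  proof
    fix x assume x: "x \<in> M"
    have xc: "x \<in> carrier R" using ideal_mem(1)[OF idM x] .
    have "x [^] (2::nat) = x \<otimes> x" using xc by (simp add: numeral_2_eq_2)
    then have "x [^] (2::nat) \<in> H"
      using ideal_prod.prod[OF x x, of R] M2I IH by auto
    then have "x \<in> radical R H" using xc unfolding radical_def by (auto intro!: exI[of _ 2])
    then show "x \<in> H" using idH(3) by simp
  qed
  then have HM: "H = M"
    using maximalideal.I_maximal[OF M idH(1)] idH(2) ideal_mem(1)[OF idH(1)] by blast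
  have "\<not> L \<subseteq> M"
  proof
    assume "L \<subseteq> M"
    then have "I \<subseteq> M \<cdot> M" unfolding IHL HM by (intro ideal_prod_mono) auto
    then show False using aI a2 by blast
  qed
  then have "\<one> \<in> L <+> M" using maximalideal_add[OF M L] by simp
  then obtain l m where lm: "l \<in> L" "m \<in> M" "\<one> = l \<oplus> m" by (auto simp: set_add_iff)
  have lc: "l \<in> carrier R" and mc: "m \<in> carrier R"
    using ideal_mem(1)[OF L lm(1)] ideal_mem(1)[OF idM lm(2)] .
  \<comment> \<open>After squaring, \<open>m \<otimes> m\<close> is the only term without a factor
    \<open>l\<close>, and it lies in \<open>M\<^sup>2\<close>, which is contained in
    \<open>L\<close>.\<close>
  have "\<one> = (l \<oplus> m) \<otimes> (l \<oplus> m)" using lm(3) by (metis l_one one_closed)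
  also have "\<dots> = l \<otimes> (l \<oplus> m \<oplus> m) \<oplus> m \<otimes> m" using lc mc by algebra
  also have "\<dots> \<in> L"
  proof (rule ideal_mem(3)[OF L])
    show "l \<otimes> (l \<oplus> m \<oplus> m) \<in> L" using lc mc by (intro ideal_mem(6)[OF L lm(1)]) simp
    show "m \<otimes> m \<in> L" using ideal_prod.prod[OF lm(2) lm(2), of R] M2I IL by blast
  qed
  finally have "L = carrier R" using ideal.one_imp_carrier[OF L] by blast
  then have "I = M" using IHL HM ideal_prod_one[OF idM] by simp
  obtain S where S: "finite S" "S \<subseteq> carrier R" "M = Idl S"
    using noeth reg by (rule regular_noetherianE)
  have "M \<subseteq> M \<cdot> M <+> PIdl a" using \<open>I = M\<close> I_def by simp
  then obtain n where n: "n \<in> M" "\<And>x. x \<in> M \<Longrightarrow> (\<one> \<ominus> n) \<otimes> x \<in> PIdl a"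
    using nakayama_generated[OF S(1,2) idM pa] S(3) by blast
  have nc: "n \<in> carrier R" using ideal_mem(1)[OF idM n(1)] .
  \<comment> \<open>\<open>J\<close> is the colon of \<open>PIdl a\<close> by \<open>M\<close>, the
    intended cofactor of \<open>M\<close>. It contains \<open>a\<close> and
    \<open>\<one> \<ominus> n\<close>, and splitting \<open>a\<close> as
    \<open>a(1 - n) + na\<close> exhibits it in \<open>MJ\<close>.\<close>
  define J where "J = {y \<in> carrier R. \<forall>x\<in>M. x \<otimes> y \<in> PIdl a}"
  have J: "ideal J R" unfolding J_def using ideal_mem(1)[OF idM] by (intro ideal_colon[OF pa]) blast
  have "M \<cdot> J \<subseteq> PIdl a" by (rule ideal_prod_subset[OF pa]) (simp add: J_def)
  moreover have "PIdl a \<subseteq> M \<cdot> J"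
  proof (rule cgenideal_minimal[OF ideal_prod_is_ideal[OF idM J]])
    have "a \<in> J"
      using ac ideal_mem(1)[OF idM] ideal_mem(5)[OF pa cgenideal_self[OF ac]] by (simp add: J_def)
    have "\<one> \<ominus> n \<in> J"
      using nc n(2) ideal_mem(1)[OF idM] by (auto simp: J_def m_comm)
    have "a = a \<otimes> (\<one> \<ominus> n) \<oplus> n \<otimes> a" using ac nc by algebra
    also have "\<dots> \<in> M \<cdot> J"
      using aM n(1) \<open>a \<in> J\<close> \<open>\<one> \<ominus> n \<in> J\<close> by (intro ideal_prod.intros)
    finally show "a \<in> M \<cdot> J" .
  qed
  ultimately show ?thesis unfolding divides_regular_def using idM J a by blast
qed

text \<open>The Noetherian induction takes the form of a maximal counterexample \<open>I\<close>;
  Nakayama excludes \<open>K = I\<close>, since that would give \<open>I = MI\<close>.\<close>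

theorem dedekind_ring_if_radical_factor:
  assumes marot: "marot_ring R" and noeth: "regular_noetherian R"
    and fact: "\<And>I. proper_regular_ideal R I \<Longrightarrow>
      \<exists>H L. radical_ideal R H \<and> ideal L R \<and> I = H \<cdot> L"
  shows "dedekind_ring R"
proof (rule ccontr)
  define F where "F = {I. proper_regular_ideal R I \<and>
    \<not> (\<exists>Ps. Ps \<noteq> [] \<and> (\<forall>P \<in> set Ps. primeideal P R) \<and> I = ideal_list_prod R Ps)}"
  assume "\<not> dedekind_ring R"
  then have neF: "F \<noteq> {}" by (auto simp: F_def dedekind_ring_def)
  have regF: "\<And>J. J \<in> F \<Longrightarrow> regular_ideal R J"
    by (auto simp: F_def proper_regular_ideal_def)
  obtain I where I: "I \<in> F" and max: "\<And>J. \<lbrakk>J \<in> F; I \<subseteq> J\<rbrakk> \<Longrightarrow> J = I"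
    using regular_noetherian_maximal[OF noeth neF regF] by blast
  have prI: "proper_regular_ideal R I" and regI: "regular_ideal R I" and idI: "ideal I R"
    using I by (auto simp: F_def proper_regular_ideal_def regular_ideal_def)
  obtain M where M: "maximalideal M R" "regular_ideal R M" "I \<subseteq> M"
    using regular_noetherian_maximalideal[OF noeth prI] by blast
  have idM: "ideal M R" and neM: "M \<noteq> carrier R" and prM: "primeideal M R"
    using M maximalideal.axioms(1) maximalideal.I_notcarr maximalideal_prime by blast+
  have "divides_regular M" by (rule maximalideal_divides_regular[OF marot noeth fact M(1,2)])
  then obtain K where K: "ideal K R" "I = M \<cdot> K" using divides_regular_divides idI M(3) by blast
  have IK: "I \<subseteq> K" unfolding K(2) by (rule ideal_prod_sub2[OF idM K(1)])
  have "K \<noteq> I" using regular_ideal_neq_prod[OF noeth regI idM neM] K(2) by auto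
  then have "K \<notin> F" using max IK by blast
  \<comment> \<open>The list may be empty here: \<open>K\<close> can be the whole ring, and then
    \<open>I\<close> is \<open>M\<close> itself. Prepending \<open>M\<close> makes the list
    nonempty.\<close>
  have "\<exists>Ps. (\<forall>P \<in> set Ps. primeideal P R) \<and> K = ideal_list_prod R Ps"
  proof (cases "K = carrier R")
    case True
    then show ?thesis by (intro exI[of _ "[]"]) (simp add: ideal_list_prod_Nil)
  next
    case False
    then have "proper_regular_ideal R K"
      using regular_ideal_mono[OF regI K(1) IK] by (simp add: proper_regular_ideal_def)
    then show ?thesis using \<open>K \<notin> F\<close> by (auto simp: F_def)
  qed
  then obtain Ps where Ps: "\<forall>P \<in> set Ps. primeideal P R" "K = ideal_list_prod R Ps" by blast
  then have "(\<forall>P \<in> set (M # Ps). primeideal P R) \<and> I = ideal_list_prod R (M # Ps)"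
    using prM K(2) Ps by (simp add: ideal_list_prod_Cons)
  then have "I \<notin> F" unfolding F_def by blast
  then show False using I by blast
qed

section \<open>Dedekind rings\<close>

text \<open>\<open>a\<close> is nonzero in the domain \<open>R/P\<close> and cancels there.
  Congruences modulo \<open>P\<close> are written as equations with an error term in
  \<open>P\<close>, so no quotient ring is formed.\<close>

lemma primeideal_cancel:
  assumes P: "primeideal P R" and a: "a \<in> carrier R" "a \<notin> P"
    and x: "x \<in> carrier R" and y: "y \<in> carrier R" and p: "p \<in> P" and eq: "a \<otimes> x = a \<otimes> y \<oplus> p"
  shows "\<exists>p'\<in>P. x = y \<oplus> p'"
proof -
  have pc: "p \<in> carrier R" using ideal_mem(1)[OF primeideal.axioms(1)[OF P] p] .
  have "a \<otimes> (x \<ominus> y) = a \<otimes> x \<ominus> a \<otimes> y" using a x y by algebra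
  also have "\<dots> = p" unfolding eq using a y pc by algebra
  finally have "a \<otimes> (x \<ominus> y) \<in> P" using p by simp
  then have "x \<ominus> y \<in> P" using primeideal.I_prime[OF P a(1)] a(2) x y by blast
  moreover have "x = y \<oplus> (x \<ominus> y)" using x y by algebra
  ultimately show ?thesis by blast
qed

lemma PIdl_prod_add_iff:
  assumes "a \<in> carrier R" "ideal X R"
  shows "z \<in> (PIdl a) \<cdot> X <+> P \<longleftrightarrow> (\<exists>x\<in>X. \<exists>p\<in>P. z = a \<otimes> x \<oplus> p)"
proof -
  have "z \<in> (PIdl a) \<cdot> X <+> P \<longleftrightarrow> (\<exists>y\<in>(PIdl a) \<cdot> X. \<exists>p\<in>P. z = y \<oplus> p)"
    by (simp only: set_add_iff)
  then show ?thesis unfolding Bex_def PIdl_prod[OF assms] by blast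
qed

lemma add_PIdl_iff:
  assumes P: "ideal P R" and a: "a \<in> carrier R"
  shows "z \<in> P <+> PIdl a \<longleftrightarrow> (\<exists>t\<in>carrier R. \<exists>p\<in>P. z = a \<otimes> t \<oplus> p)"
proof -
  have eq: "p \<oplus> t \<otimes> a = a \<otimes> t \<oplus> p" if "t \<in> carrier R" "p \<in> P" for t p
    using that ideal_mem(1)[OF P] a by (simp add: m_comm a_comm)
  have "z \<in> P <+> PIdl a \<longleftrightarrow> (\<exists>t\<in>carrier R. \<exists>p\<in>P. z = p \<oplus> t \<otimes> a)"
    unfolding set_add_iff Bex_def PIdl_iff[unfolded Bex_def] by blast
  also have "\<dots> \<longleftrightarrow> (\<exists>t\<in>carrier R. \<exists>p\<in>P. z = a \<otimes> t \<oplus> p)"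
    by (intro bex_cong refl) (simp add: eq)
  finally show ?thesis .
qed

text \<open>In the notation of the proof, \<open>Q\<close> is a prime factor of \<open>P + (a)\<close>, so \<open>Q\<close> is invertible
  modulo \<open>P\<close>. Factoring \<open>Q\<^sup>2 + P\<close> gives \<open>P \<subseteq> Q\<^sup>2\<close>. If \<open>c \<in> Q\<close> is not in \<open>Q\<^sup>2 + P\<close>,
  then \<open>QY + P = P + (c)\<close> for some \<open>Y\<close> not contained in \<open>Q\<close>, whereas
  \<open>PY \<subseteq> Q\<^sup>2Y \<subseteq> Q(P + (c))\<close> forces \<open>PY \<subseteq> PQ\<close> and hence \<open>Y \<subseteq> Q\<close>.\<close>

lemma dedekind_prime_maximal:
  assumes ded: "dedekind_ring R" and P: "primeideal P R" and dP: "divides_regular P"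
    and a: "a \<in> carrier R" "a \<notin> P"
  shows "P <+> PIdl a = carrier R"
proof (rule ccontr)
  assume ne: "P <+> PIdl a \<noteq> carrier R"
  note idP = primeideal.axioms(1)[OF P]
  note regP = divides_regular_imp_regular[OF dP]
  have pa: "ideal (PIdl a) R" by (rule cgenideal_ideal[OF a(1)])
  define B where "B = P <+>\<^bsub>R\<^esub> PIdl a"
  have B: "ideal B R" unfolding B_def by (rule add_ideals[OF idP pa])
  have PB: "P \<subseteq> B" unfolding B_def by (rule set_add_sub1[OF idP pa])
  have aB: "a \<in> B" unfolding B_def using set_add_sub2[OF idP pa] cgenideal_self[OF a(1)] by blast
  have "proper_regular_ideal R B"
    using regular_ideal_mono[OF regP B PB] ne by (simp add: proper_regular_ideal_def B_def)
  then obtain Qs where Qs: "Qs \<noteq> []" "\<forall>Q\<in>set Qs. primeideal Q R" "B = ideal_list_prod R Qs"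
    using ded unfolding dedekind_ring_def by blast
  then obtain Q Qs' where Qs': "Qs = Q # Qs'" by (cases Qs) auto
  define X where "X = ideal_list_prod R Qs'"
  have Q: "primeideal Q R" and X: "ideal X R" and BQX: "B = Q \<cdot> X"
    using Qs Qs' ideal_list_prod_ideal[of Qs'] primeideal.axioms(1)
    by (auto simp: X_def ideal_list_prod_Cons)
  note idQ = primeideal.axioms(1)[OF Q]
  have BQ: "B \<subseteq> Q" unfolding BQX by (rule ideal_prod_sub1[OF idQ X])
  have PQ: "P \<subseteq> Q" and aQ: "a \<in> Q" using PB BQ aB by blast+
  \<comment> \<open>This is one half of \<open>QX = (a)\<close> modulo \<open>P\<close>; the other
    half is \<open>aB\<close> with \<open>BQX\<close>.\<close>
  have QX: "z \<in> Q \<cdot> X \<Longrightarrow> \<exists>t\<in>carrier R. \<exists>p\<in>P. z = a \<otimes> t \<oplus> p" for z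
    using BQX add_PIdl_iff[OF idP a(1)] by (auto simp: B_def)
  define C where "C = Q \<cdot> Q <+>\<^bsub>R\<^esub> P"
  have QQ: "ideal (Q \<cdot> Q) R" by (rule ideal_prod_is_ideal[OF idQ idQ])
  have C: "ideal C R" unfolding C_def by (rule add_ideals[OF QQ idP])
  have QQC: "Q \<cdot> Q \<subseteq> C" and PC: "P \<subseteq> C"
    unfolding C_def using set_add_sub1[OF QQ idP] set_add_sub2[OF QQ idP] .
  have CQ: "C \<subseteq> Q"
    unfolding C_def by (rule set_add_least[OF idQ ideal_prod_sub1[OF idQ idQ] PQ])
  \<comment> \<open>Multiplying \<open>QL \<subseteq> Q\<^sup>2 + P\<close> by \<open>X\<close>
    turns a factor \<open>Q\<close> on each side into \<open>a\<close> modulo \<open>P\<close>, and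
    \<open>a\<close> cancels modulo the prime \<open>P\<close>. Since
    \<open>P \<subseteq> Q\<close>, this leaves \<open>L \<subseteq> Q\<close>.\<close>
  have cancelQ: "L \<subseteq> Q" if L: "ideal L R" and sub: "Q \<cdot> L \<subseteq> C" for L
  proof
    fix l assume l: "l \<in> L"
    have lc: "l \<in> carrier R" using ideal_mem(1)[OF L l] .
    \<comment> \<open>\<open>D\<close> is where \<open>C\<close> lands after multiplication by
      elements of \<open>X\<close>, because \<open>XQ\<close> consists of multiples of
      \<open>a\<close> modulo \<open>P\<close>.\<close>
    define D where "D = (PIdl a) \<cdot> Q <+>\<^bsub>R\<^esub> P"
    have D: "ideal D R" unfolding D_def by (intro add_ideals ideal_prod_is_ideal pa idQ idP)
    have PD: "P \<subseteq> D"
      unfolding D_def by (rule set_add_sub2[OF ideal_prod_is_ideal[OF pa idQ] idP])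
    have D2: "ideal {y \<in> carrier R. \<forall>x\<in>X. x \<otimes> y \<in> D} R"
      using ideal_mem(1)[OF X] by (intro ideal_colon[OF D]) blast
    have "Q \<cdot> Q \<subseteq> {y \<in> carrier R. \<forall>x\<in>X. x \<otimes> y \<in> D}"
    proof (rule ideal_prod_subset[OF D2])
      fix q q' assume q: "q \<in> Q" "q' \<in> Q"
      have qc: "q \<in> carrier R" "q' \<in> carrier R" using ideal_mem(1)[OF idQ] q by auto
      have "x \<otimes> (q \<otimes> q') \<in> D" if x: "x \<in> X" for x
      proof -
        have xc: "x \<in> carrier R" using ideal_mem(1)[OF X x] .
        obtain t p where tp: "t \<in> carrier R" "p \<in> P" "q \<otimes> x = a \<otimes> t \<oplus> p"
          using QX[OF ideal_prod.prod[OF q(1) x]] by blast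
        have pc: "p \<in> carrier R" using ideal_mem(1)[OF idP tp(2)] .
        have "x \<otimes> (q \<otimes> q') = (q \<otimes> x) \<otimes> q'" using qc xc by algebra
        also have "\<dots> = a \<otimes> (t \<otimes> q') \<oplus> p \<otimes> q'"
          unfolding tp(3) using a tp(1) pc qc by algebra
        finally show ?thesis
          unfolding D_def PIdl_prod_add_iff[OF a(1) idQ]
          using ideal_mem(5)[OF idQ q(2) tp(1)] ideal_mem(6)[OF idP tp(2) qc(2)] by blast
      qed
      then show "q \<otimes> q' \<in> {y \<in> carrier R. \<forall>x\<in>X. x \<otimes> y \<in> D}" using qc by simp
    qed
    moreover have "P \<subseteq> {y \<in> carrier R. \<forall>x\<in>X. x \<otimes> y \<in> D}"
      using PD ideal_mem(1,5)[OF idP] ideal_mem(1)[OF X] by blast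
    ultimately have CD: "C \<subseteq> {y \<in> carrier R. \<forall>x\<in>X. x \<otimes> y \<in> D}"
      unfolding C_def by (rule set_add_least[OF D2])
    have "Q \<cdot> X \<subseteq> {y \<in> carrier R. l \<otimes> y \<in> D}"
    proof (rule ideal_prod_subset[OF ideal_colon_elem[OF D lc]])
      fix q x assume q: "q \<in> Q" and x: "x \<in> X"
      have qc: "q \<in> carrier R" and xc: "x \<in> carrier R"
        using ideal_mem(1)[OF idQ q] ideal_mem(1)[OF X x] .
      have "q \<otimes> l \<in> C" using ideal_prod.prod[OF q l, of R] sub by blast
      then have "x \<otimes> (q \<otimes> l) \<in> D" using CD x by blast
      moreover have "x \<otimes> (q \<otimes> l) = l \<otimes> (q \<otimes> x)" using qc xc lc by algebra
      ultimately show "q \<otimes> x \<in> {y \<in> carrier R. l \<otimes> y \<in> D}" using qc xc by simp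
    qed
    then have "l \<otimes> a \<in> D" using aB BQX by blast
    then obtain q p where qp: "q \<in> Q" "p \<in> P" "l \<otimes> a = a \<otimes> q \<oplus> p"
      unfolding D_def PIdl_prod_add_iff[OF a(1) idQ] by blast
    have "a \<otimes> l = a \<otimes> q \<oplus> p" using qp(3) a lc by (simp add: m_comm)
    then obtain p' where "p' \<in> P" "l = q \<oplus> p'"
      using primeideal_cancel[OF P a lc ideal_mem(1)[OF idQ qp(1)] qp(2)] by blast
    then show "l \<in> Q" using ideal_mem(3)[OF idQ qp(1)] PQ by blast
  qed
  \<comment> \<open>A prime factor \<open>Q'\<close> of \<open>C\<close> inside \<open>Q\<close>
    contains \<open>Q\<^sup>2\<close>, hence equals \<open>Q\<close>, and \<open>cancelQ\<close>
    puts its cofactor into \<open>Q\<close> as well.\<close>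
  have "proper_regular_ideal R C"
    using regular_ideal_mono[OF regP C PC] CQ ideal_mem(1)[OF idQ] primeideal.I_notcarr[OF Q]
    by (auto simp: proper_regular_ideal_def)
  then obtain Rs where Rs: "\<forall>P\<in>set Rs. primeideal P R" "C = ideal_list_prod R Rs"
    using ded unfolding dedekind_ring_def by blast
  have idRs: "\<And>I. I \<in> set Rs \<Longrightarrow> ideal I R" using Rs(1) primeideal.axioms(1) by blast
  obtain Q' where Q': "Q' \<in> set Rs" "Q' \<subseteq> Q"
    using primeideal_list_prod_subset[OF Q idRs] CQ Rs(2) by blast
  obtain L where L: "ideal L R" "C = Q' \<cdot> L"
    using ideal_list_prod_remove[OF idRs Q'(1)] Rs(2) by blast
  have "Q \<cdot> Q \<subseteq> Q'"
    using QQC ideal_prod_sub1[OF idRs[OF Q'(1)] L(1)] L(2) by blast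
  then have "Q \<subseteq> Q'" using primeideal_prod_subset[OF _ idQ idQ] Rs(1) Q'(1) by blast
  then have "Q' = Q" using Q'(2) by blast
  then have CQL: "C = Q \<cdot> L" using L(2) by simp
  then have "L \<subseteq> Q" by (intro cancelQ[OF L(1)]) simp
  then have PQQ: "P \<subseteq> Q \<cdot> Q" using PC CQL ideal_prod_mono[OF order_refl] by blast
  \<comment> \<open>Otherwise \<open>cancelQ\<close> applies to the unit ideal.\<close>
  have "\<not> Q \<subseteq> C"
  proof
    assume "Q \<subseteq> C"
    then have "carrier R \<subseteq> Q" by (intro cancelQ[OF oneideal]) (simp add: ideal_prod_one[OF idQ])
    then show False using primeideal.I_notcarr[OF Q] ideal_mem(1)[OF idQ] by blast
  qed
  then obtain c where cQ: "c \<in> Q" and cC: "c \<notin> C" by blast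
  have c: "c \<in> carrier R" "c \<notin> P" using ideal_mem(1)[OF idQ cQ] cC PC by blast+
  have pc: "ideal (PIdl c) R" by (rule cgenideal_ideal[OF c(1)])
  define E where "E = (PIdl c) \<cdot> X <+>\<^bsub>R\<^esub> P"
  have E: "ideal E R" unfolding E_def by (intro add_ideals ideal_prod_is_ideal pc X idP)
  \<comment> \<open>Modulo \<open>P\<close>, \<open>X\<close> is \<open>a\<close> times the inverse
    of \<open>Q\<close>, so \<open>Y\<close>, the quotient of \<open>cX + P\<close> by
    \<open>a\<close>, plays the role of \<open>c\<close> times that inverse.\<close>
  define Y where "Y = {y \<in> carrier R. a \<otimes> y \<in> E}"
  have Y: "ideal Y R" unfolding Y_def by (rule ideal_colon_elem[OF E a(1)])
  \<comment> \<open>Modulo \<open>P\<close>, \<open>a(qy)\<close> is \<open>c(qx)\<close> for some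
    \<open>x \<in> X\<close>, and \<open>qx\<close> is a multiple of \<open>a\<close>; then
    \<open>a\<close> cancels.\<close>
  have QY: "\<exists>t\<in>carrier R. \<exists>p\<in>P. q \<otimes> y = c \<otimes> t \<oplus> p" if q: "q \<in> Q" and y: "y \<in> Y" for q y
  proof -
    have qc: "q \<in> carrier R" and yc: "y \<in> carrier R"
      using ideal_mem(1)[OF idQ q] ideal_mem(1)[OF Y y] .
    obtain x p where xp: "x \<in> X" "p \<in> P" "a \<otimes> y = c \<otimes> x \<oplus> p"
      using y PIdl_prod_add_iff[OF c(1) X] by (auto simp: Y_def E_def)
    obtain t p' where tp: "t \<in> carrier R" "p' \<in> P" "q \<otimes> x = a \<otimes> t \<oplus> p'"
      using QX[OF ideal_prod.prod[OF q xp(1)]] by blast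
    have carr: "x \<in> carrier R" "p \<in> carrier R" "p' \<in> carrier R"
      using ideal_mem(1)[OF X xp(1)] ideal_mem(1)[OF idP xp(2)] ideal_mem(1)[OF idP tp(2)] .
    have "a \<otimes> (q \<otimes> y) = q \<otimes> (a \<otimes> y)" using a qc yc by algebra
    also have "\<dots> = c \<otimes> (q \<otimes> x) \<oplus> q \<otimes> p" unfolding xp(3) using c qc carr by algebra
    also have "\<dots> = a \<otimes> (c \<otimes> t) \<oplus> (c \<otimes> p' \<oplus> q \<otimes> p)"
      unfolding tp(3) using a c qc carr tp(1) by algebra
    finally show ?thesis
      using primeideal_cancel[OF P a, of "q \<otimes> y" "c \<otimes> t" "c \<otimes> p' \<oplus> q \<otimes> p"] qc yc c(1) tp(1)
        ideal_mem(3)[OF idP ideal_mem(5)[OF idP tp(2) c(1)] ideal_mem(5)[OF idP xp(2) qc]]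
      by auto
  qed
  have "\<not> Y \<subseteq> Q"
  proof
    assume YQ: "Y \<subseteq> Q"
    have idQY: "ideal (Q \<cdot> Y) R" by (rule ideal_prod_is_ideal[OF idQ Y])
    \<comment> \<open>If \<open>Y \<subseteq> Q\<close>, then \<open>cQX\<close> lies in
      \<open>aQY + P\<close>. As \<open>a \<in> QX\<close>, cancelling \<open>a\<close> modulo
      \<open>P\<close> puts \<open>c\<close> in \<open>QY + P\<close>, hence in
      \<open>C\<close>.\<close>
    define G where "G = (PIdl a) \<cdot> (Q \<cdot> Y) <+>\<^bsub>R\<^esub> P"
    have G: "ideal G R" unfolding G_def by (intro add_ideals ideal_prod_is_ideal pa idQ Y idP)
    have "Q \<cdot> X \<subseteq> {z \<in> carrier R. c \<otimes> z \<in> G}"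
    proof (rule ideal_prod_subset[OF ideal_colon_elem[OF G c(1)]])
      fix q x assume q: "q \<in> Q" and x: "x \<in> X"
      have qc: "q \<in> carrier R" and xc: "x \<in> carrier R"
        using ideal_mem(1)[OF idQ q] ideal_mem(1)[OF X x] .
      obtain t p where tp: "t \<in> carrier R" "p \<in> P" "c \<otimes> x = a \<otimes> t \<oplus> p"
        using QX[OF ideal_prod.prod[OF cQ x]] by blast
      have pc: "p \<in> carrier R" using ideal_mem(1)[OF idP tp(2)] .
      have "a \<otimes> t = c \<otimes> x \<oplus> (\<zero> \<ominus> p)" unfolding tp(3) using a tp(1) pc by algebra
      moreover have "\<zero> \<ominus> p \<in> P" using ideal_mem(2,4)[OF idP] tp(2) by blast
      ultimately have "a \<otimes> t \<in> E" unfolding E_def PIdl_prod_add_iff[OF c(1) X] using x by blast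
      then have tY: "t \<in> Y" using tp(1) by (simp add: Y_def)
      have "c \<otimes> (q \<otimes> x) = q \<otimes> (c \<otimes> x)" using c qc xc by algebra
      also have "\<dots> = a \<otimes> (q \<otimes> t) \<oplus> q \<otimes> p" unfolding tp(3) using a qc tp(1) pc by algebra
      finally have "c \<otimes> (q \<otimes> x) \<in> G"
        unfolding G_def PIdl_prod_add_iff[OF a(1) idQY]
        using ideal_prod.prod[OF q tY, of R] ideal_mem(5)[OF idP tp(2) qc] by blast
      then show "q \<otimes> x \<in> {z \<in> carrier R. c \<otimes> z \<in> G}" using qc xc by simp
    qed
    then have "c \<otimes> a \<in> G" using aB BQX by blast
    then obtain w p where wp: "w \<in> Q \<cdot> Y" "p \<in> P" "c \<otimes> a = a \<otimes> w \<oplus> p"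
      unfolding G_def PIdl_prod_add_iff[OF a(1) idQY] by blast
    have "a \<otimes> c = a \<otimes> w \<oplus> p" using wp(3) a c by (simp add: m_comm)
    then obtain p' where p': "p' \<in> P" "c = w \<oplus> p'"
      using primeideal_cancel[OF P a c(1) ideal_mem(1)[OF idQY wp(1)] wp(2)] by blast
    have "w \<in> Q \<cdot> Q" using wp(1) ideal_prod_mono[OF order_refl YQ] by blast
    then have "c \<in> C" unfolding C_def set_add_iff using p' by blast
    then show False using cC by blast
  qed
  moreover have "Y \<subseteq> Q"
  proof (rule divides_regular_cancel[OF dP Y idQ])
    have idPQ: "ideal (P \<cdot> Q) R" by (rule ideal_prod_is_ideal[OF idP idQ])
    \<comment> \<open>\<open>Q(QY)\<close> lies in \<open>Q((c) + P)\<close>, that is, in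
      \<open>cQ + PQ\<close>; as \<open>P \<subseteq> Q\<^sup>2\<close>, so does
      \<open>PY\<close>.\<close>
    define G where "G = (PIdl c) \<cdot> Q <+>\<^bsub>R\<^esub> P \<cdot> Q"
    have G: "ideal G R" unfolding G_def by (intro add_ideals ideal_prod_is_ideal pc idQ idP)
    have "Q \<cdot> (Q \<cdot> Y) \<subseteq> G"
    proof (rule ideal_prod_subset[OF G])
      fix q w assume q: "q \<in> Q" and w: "w \<in> Q \<cdot> Y"
      have qc: "q \<in> carrier R" using ideal_mem(1)[OF idQ q] .
      have "Q \<cdot> Y \<subseteq> {w \<in> carrier R. q \<otimes> w \<in> G}"
      proof (rule ideal_prod_subset[OF ideal_colon_elem[OF G qc]])
        fix q' y assume q': "q' \<in> Q" and y: "y \<in> Y"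
        obtain t p where tp: "t \<in> carrier R" "p \<in> P" "q' \<otimes> y = c \<otimes> t \<oplus> p"
          using QY[OF q' y] by blast
        have carr: "q' \<in> carrier R" "y \<in> carrier R" "p \<in> carrier R"
          using ideal_mem(1)[OF idQ q'] ideal_mem(1)[OF Y y] ideal_mem(1)[OF idP tp(2)] .
        have "q \<otimes> (q' \<otimes> y) = c \<otimes> (q \<otimes> t) \<oplus> p \<otimes> q"
          unfolding tp(3) using c qc tp(1) carr by algebra
        then have "q \<otimes> (q' \<otimes> y) \<in> G"
          unfolding G_def PIdl_prod_add_iff[OF c(1) idQ]
          using ideal_mem(6)[OF idQ q tp(1)] ideal_prod.prod[OF tp(2) q, of R] by blast
        then show "q' \<otimes> y \<in> {w \<in> carrier R. q \<otimes> w \<in> G}" using carr by simp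
      qed
      then show "q \<otimes> w \<in> G" using w by blast
    qed
    then have "(Q \<cdot> Q) \<cdot> Y \<subseteq> G" by (simp add: ideal_prod_assoc[OF idQ idQ Y])
    then have "P \<cdot> Y \<subseteq> G" using ideal_prod_mono[OF PQQ order_refl[of Y]] by blast
    show "P \<cdot> Y \<subseteq> P \<cdot> Q"
    proof
      fix z assume z: "z \<in> P \<cdot> Y"
      then obtain q e where qe: "q \<in> Q" "e \<in> P \<cdot> Q" "z = c \<otimes> q \<oplus> e"
        using \<open>P \<cdot> Y \<subseteq> G\<close> PIdl_prod_add_iff[OF c(1) idQ] unfolding G_def by blast
      have zP: "z \<in> P" and eP: "e \<in> P"
        using z qe(2) ideal_prod_sub1[OF idP Y] ideal_prod_sub1[OF idP idQ] by blast+
      have carr: "q \<in> carrier R" "e \<in> carrier R"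
        using ideal_mem(1)[OF idQ qe(1)] ideal_mem(1)[OF idP eP] .
      \<comment> \<open>The multiple of \<open>c\<close> is a difference of elements of
        \<open>P\<close>, and \<open>c \<notin> P\<close>, so \<open>q \<in> P\<close>; since
        \<open>c \<in> Q\<close>, even \<open>c \<otimes> q \<in> PQ\<close>.\<close>
      have "c \<otimes> q = z \<ominus> e" unfolding qe(3) using c carr by algebra
      then have "c \<otimes> q \<in> P" using ideal_mem(4)[OF idP zP eP] by simp
      then have "q \<in> P" using primeideal.I_prime[OF P c(1) carr(1)] c(2) by blast
      then have "c \<otimes> q \<in> P \<cdot> Q"
        using ideal_prod.prod[of q P c Q R] cQ c carr by (simp add: m_comm)
      then show "z \<in> P \<cdot> Q" unfolding qe(3) using qe(2) by (rule ideal_mem(3)[OF idPQ])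
    qed
  qed
  ultimately show False by blast
qed

lemma dedekind_prime_divides_regular:
  assumes ded: "dedekind_ring R" and P: "primeideal P R" and reg: "regular_ideal R P"
  shows "divides_regular P"
proof -
  note idP = primeideal.axioms(1)[OF P]
  obtain r where r: "r \<in> P" "r \<in> regular_elems R" using reg by (auto simp: regular_ideal_def)
  have rc: "r \<in> carrier R" using r(2) by simp
  have pr: "ideal (PIdl r) R" by (rule cgenideal_ideal[OF rc])
  have rP: "PIdl r \<subseteq> P" by (rule cgenideal_minimal[OF idP r(1)])
  have "PIdl r \<noteq> carrier R" using rP primeideal.I_notcarr[OF P] ideal_mem(1)[OF idP] by blast
  then have "proper_regular_ideal R (PIdl r)"
    using pr r(2) cgenideal_self[OF rc] by (auto simp: proper_regular_ideal_def regular_ideal_def)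
  then obtain Qs where Qs: "\<forall>Q\<in>set Qs. primeideal Q R" "PIdl r = ideal_list_prod R Qs"
    using ded unfolding dedekind_ring_def by blast
  have idQs: "\<And>I. I \<in> set Qs \<Longrightarrow> ideal I R" using Qs(1) primeideal.axioms(1) by blast
  obtain Q where Q: "Q \<in> set Qs" "Q \<subseteq> P"
    using primeideal_list_prod_subset[OF P idQs] rP unfolding Qs(2) by blast
  obtain L where L: "ideal L R" "PIdl r = Q \<cdot> L"
    using ideal_list_prod_remove[OF idQs Q(1)] Qs(2) by auto
  have dQ: "divides_regular Q"
    using divides_regular_factor[OF idQs[OF Q(1)] L(1)] divides_regular_PIdl[OF r(2)] L(2) by simp
  \<comment> \<open>An \<open>a\<close> in \<open>P\<close> outside \<open>Q\<close> would make
    \<open>Q + (a)\<close> the whole ring, yet that ideal is contained in the proper ideal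
    \<open>P\<close>.\<close>
  have "P \<subseteq> Q"
  proof (rule ccontr)
    assume "\<not> P \<subseteq> Q"
    then obtain a where a: "a \<in> P" "a \<notin> Q" by blast
    then have "Q <+> PIdl a = carrier R"
      using dedekind_prime_maximal[OF ded _ dQ] Qs(1) Q(1) ideal_mem(1)[OF idP] by blast
    moreover have "Q <+> PIdl a \<subseteq> P"
      by (rule set_add_least[OF idP Q(2) cgenideal_minimal[OF idP a(1)]])
    ultimately show False using primeideal.I_notcarr[OF P] ideal_mem(1)[OF idP] by blast
  qed
  then show ?thesis using dQ Q(2) by (simp add: subset_antisym)
qed

lemma divides_regular_list_prod:
  "(\<And>I. I \<in> set Is \<Longrightarrow> divides_regular I) \<Longrightarrow> divides_regular (ideal_list_prod R Is)"
proof (induction Is)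
  case Nil
  have "PIdl \<one> = carrier R" using genideal_one by (simp add: cgenideal_eq_genideal)
  then show ?case using divides_regular_PIdl[OF regular_elems_one] by (simp add: ideal_list_prod_Nil)
qed (simp add: ideal_list_prod_Cons divides_regular_mult)

theorem dedekind_ring_imp_regular_noetherian:
  assumes ded: "dedekind_ring R"
  shows "regular_noetherian R"
  unfolding regular_noetherian_def
proof (intro allI impI)
  fix I assume reg: "regular_ideal R I"
  then have idI: "ideal I R" by (simp add: regular_ideal_def)
  have "\<exists>Ps. (\<forall>P\<in>set Ps. primeideal P R) \<and> I = ideal_list_prod R Ps"
  proof (cases "I = carrier R")
    case True
    then show ?thesis by (intro exI[of _ "[]"]) (simp add: ideal_list_prod_Nil)
  next
    case False
    then show ?thesis
      using ded reg unfolding dedekind_ring_def proper_regular_ideal_def by blast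
  qed
  then obtain Ps where Ps: "\<forall>P\<in>set Ps. primeideal P R" "I = ideal_list_prod R Ps" by blast
  have idPs: "\<And>P. P \<in> set Ps \<Longrightarrow> ideal P R" using Ps(1) primeideal.axioms(1) by blast
  \<comment> \<open>A factor of \<open>I\<close> contains \<open>I\<close>, hence a regular
    element.\<close>
  have "divides_regular P" if P: "P \<in> set Ps" for P
  proof -
    obtain L where L: "ideal L R" "I = P \<cdot> L" using ideal_list_prod_remove[OF idPs P] Ps(2) by blast
    then have "I \<subseteq> P" using ideal_prod_sub1[OF idPs[OF P]] by blast
    then show ?thesis
      using dedekind_prime_divides_regular[OF ded] Ps(1) P regular_ideal_mono[OF reg idPs[OF P]]
      by blast
  qed
  then have "divides_regular I" unfolding Ps(2) by (rule divides_regular_list_prod)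
  then show "\<exists>S. finite S \<and> S \<subseteq> carrier R \<and> I = Idl S"
    by (rule divides_regular_finitely_generated)
qed

section \<open>Products of radical ideals\<close>

lemma primeideal_radical_ideal:
  assumes P: "primeideal P R"
  shows "radical_ideal R P"
proof -
  note idP = primeideal.axioms(1)[OF P]
  have "x \<in> P" if x: "x \<in> carrier R" and "x [^] n \<in> P" for x and n :: nat
    using that(2)
  proof (induction n)
    case 0
    \<comment> \<open>The induction starts at exponent 0, below the exponents that
      \<open>radical\<close> allows; there \<open>\<one> \<in> P\<close> makes the claim
      trivial.\<close>
    then have "P = carrier R" using ideal.one_imp_carrier[OF idP] by simp
    then show ?case using x by simp
  next
    case (Suc n)
    then show ?case using primeideal.I_prime[OF P, of "x [^] n" x] x by auto
  qed
  moreover have "x [^] (1::nat) \<in> P" if "x \<in> P" for x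
    using that ideal_mem(1)[OF idP that] by simp
  ultimately have "radical R P = P"
    using ideal_mem(1)[OF idP] zero_less_one unfolding radical_def by blast
  then show ?thesis using idP primeideal.I_notcarr[OF P] by (auto simp: radical_ideal_def)
qed

lemma dedekind_ring_imp_SP_ring: "dedekind_ring R \<Longrightarrow> SP_ring R"
  unfolding dedekind_ring_def SP_ring_def using primeideal_radical_ideal by meson

text \<open>The embedded ring is its own inverse. It serves as the invertible factor when an SP
  factorization is read as an ISP factorization.\<close>

lemma invertible_ideal_carrier: "invertible_ideal R (carrier R)"
proof -
  let ?T = "total_quotient R" and ?A = "tq_embed R ` carrier R"
  interpret T: cring ?T by (rule total_quotient_cring)
  interpret M: algebra R ?T by (rule total_quotient_algebra)
  have hom: "tq_embed R \<in> ring_hom R ?T" by (rule tq_embed_hom)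
  interpret h: ring_hom_ring R ?T "tq_embed R"
    by (rule ring_hom_ringI2[OF ring_axioms T.ring_axioms hom])
  have "submodule ?A R ?T"
  proof (rule M.submoduleI)
    show "?A \<subseteq> carrier ?T" by auto
    show "\<zero>\<^bsub>?T\<^esub> \<in> ?A" by (simp flip: h.hom_zero)
    show "\<ominus>\<^bsub>?T\<^esub> x \<in> ?A" if "x \<in> ?A" for x
      using that by (auto simp flip: h.hom_a_inv)
    show "x \<oplus>\<^bsub>?T\<^esub> y \<in> ?A" if "x \<in> ?A" "y \<in> ?A" for x y
      using that by (auto simp flip: h.hom_add)
    show "a \<odot>\<^bsub>?T\<^esub> x \<in> ?A" if a: "a \<in> carrier R" and x: "x \<in> ?A" for a x
    proof -
      obtain b where b: "b \<in> carrier R" "x = tq_embed R b" using x by blast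
      then have "a \<odot>\<^bsub>?T\<^esub> x = tq_embed R (a \<otimes> b)"
        using a tq_smult_eq_embed_mult[of a x] by simp
      then show ?thesis using a b(1) by (simp del: h.hom_mult)
    qed
  qed
  moreover have "ideal_prod ?T ?A ?A = ?A"
  proof (intro equalityI subsetI)
    fix z assume "z \<in> ideal_prod ?T ?A ?A"
    then show "z \<in> ?A"
    proof induct
      case (prod i j)
      then show ?case by (auto simp flip: h.hom_mult)
    next
      case (sum s1 s2)
      then show ?case by (auto simp flip: h.hom_add)
    qed
  next
    fix z assume z: "z \<in> ?A"
    then have "z = \<one>\<^bsub>?T\<^esub> \<otimes>\<^bsub>?T\<^esub> z" by auto
    moreover have "\<one>\<^bsub>?T\<^esub> \<in> ?A" by (simp flip: h.hom_one)
    ultimately show "z \<in> ideal_prod ?T ?A ?A" using z ideal_prod.prod[of "\<one>\<^bsub>?T\<^esub>" ?A z ?A ?T] by simp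
  qed
  ultimately show ?thesis unfolding invertible_ideal_def using oneideal by blast
qed

lemma SP_ring_imp_ISP_ring:
  assumes "SP_ring R"
  shows "ISP_ring R"
  unfolding ISP_ring_def
proof (intro allI impI)
  fix I assume "proper_regular_ideal R I"
  then obtain Hs where Hs: "Hs \<noteq> []" "\<forall>H\<in>set Hs. radical_ideal R H" "I = ideal_list_prod R Hs"
    using assms unfolding SP_ring_def by blast
  then have idHs: "ideal I R" using ideal_list_prod_ideal by (auto simp: radical_ideal_def)
  have "I = carrier R \<cdot> I"
    using ideal_prod_one[OF idHs] ideal_prod_commute[OF idHs oneideal] by simp
  then show "\<exists>J Hs. invertible_ideal R J \<and> Hs \<noteq> [] \<and> (\<forall>H\<in>set Hs. radical_ideal R H) \<and>
      I = J \<cdot> ideal_list_prod R Hs"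
    using Hs invertible_ideal_carrier by blast
qed

text \<open>\<open>J\<close> commutes past the first radical factor, and everything else is
  collected in \<open>L\<close>. One radical factor with some cofactor is what
  \<open>maximalideal_divides_regular\<close> asks for.\<close>

lemma ISP_ring_radical_factor:
  assumes "ISP_ring R" and "proper_regular_ideal R I"
  shows "\<exists>H L. radical_ideal R H \<and> ideal L R \<and> I = H \<cdot> L"
proof -
  obtain J Hs where J: "invertible_ideal R J" and Hs: "Hs \<noteq> []" "\<forall>H\<in>set Hs. radical_ideal R H"
    and I: "I = J \<cdot> ideal_list_prod R Hs"
    using assms unfolding ISP_ring_def by blast
  obtain H Hs' where H: "Hs = H # Hs'" using Hs(1) by (cases Hs) auto
  have idJ: "ideal J R" using J by (simp add: invertible_ideal_def)
  have idH: "ideal H R" "ideal (ideal_list_prod R Hs') R"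
    using Hs(2) H ideal_list_prod_ideal by (auto simp: radical_ideal_def)
  have "I = H \<cdot> (J \<cdot> ideal_list_prod R Hs')"
    unfolding I H ideal_list_prod_Cons by (rule ideal_prod_lcomm[OF idJ idH])
  then show ?thesis using Hs(2) H ideal_prod_is_ideal[OF idJ idH(2)] by auto
qed

end

theorem corollary3p7:
  fixes A :: "('a, 'b) ring_scheme"
  assumes "cring A"
    and "\<one>\<^bsub>A\<^esub> \<noteq> \<zero>\<^bsub>A\<^esub>"
    and "marot_ring A"
  shows "(dedekind_ring A \<longleftrightarrow> regular_noetherian A \<and> SP_ring A) \<and>
         (regular_noetherian A \<and> SP_ring A \<longleftrightarrow> regular_noetherian A \<and> ISP_ring A)"
proof -
  interpret cring A by fact
  have "regular_noetherian A \<and> SP_ring A" if "dedekind_ring A"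
    using that dedekind_ring_imp_regular_noetherian dedekind_ring_imp_SP_ring by blast
  moreover have "dedekind_ring A" if "regular_noetherian A \<and> ISP_ring A"
    using that dedekind_ring_if_radical_factor[OF assms(3)] ISP_ring_radical_factor by blast
  \<comment> \<open>The remaining implication, from (2) to (3), closes the cycle.\<close>
  ultimately show ?thesis using SP_ring_imp_ISP_ring by blast
qed

end
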